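(* Let $\mathcal{Q}=[0,1]^2$ with elements $q=(q_1,q_2)$ and let $\nu$ be the Lebesgue measure on $\mathcal{Q}$. Let $$H(s,q)=H_{11}(s)+q_1H_{12}(s)+q_2H_{21}(s)+q_1q_2H_{22}(s),$$ where $H_{ij}\in\mathcal{H}_2$ are $\mathbb{C}^{n_{\rm o}\times n_{\rm i}}$-valued for $i,j\in\{1,2\}$. Let $$\hat H(s,q)=(\hat C_1+q_2\hat C_2)(sI-\hat A)^{-1}(\hat B_1+q_1\hat B_2),$$ with $\hat A=\operatorname{diag}(\lambda_1,\dots,\lambda_r)$, $\hat B_1,\hat B_2\in\mathbb{C}^{r\times n_{\rm i}}$, $\hat C_1,\hat C_2\in\mathbb{C}^{n_{\rm o}\times r}$, and all $\lambda_\ell$ in the open left half-plane. Define $$\mathcal{H}(s)=\begin{bmatrix} H_{11}(s) & H_{12}(s) \\ H_{21}(s) & H_{22}(s) \end{bmatrix},\qquad \hat{\mathcal{H}}(s)=\begin{bmatrix} \hat C_1 \\ \hat C_2 \end{bmatrix}(sI-\hat A)^{-1}\begin{bmatrix} \hat B_1 & \hat B_2 \end{bmatrix},$$ and, with $b_{\ell,i}=\hat B_i^*e_\ell$ and $c_{\ell,i}=\hat C_ie_\ell$ for $i=1,2$, $$\mathfrak{b}_\ell=\begin{bmatrix} I_{n_{\rm i}} & \frac12I_{n_{\rm i}} \\ \frac12I_{n_{\rm i}} & \frac13I_{n_{\rm i}} \end{bmatrix}\begin{bmatrix} b_{\ell,1} \\ b_{\ell,2} \end{bmatrix},\qquad \mathfrak{c}_\ell=\begin{bmatrix}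 I_{n_{\rm o}} & \frac12I_{n_{\rm o}} \\ \frac12I_{n_{\rm o}} & \frac13I_{n_{\rm o}} \end{bmatrix}\begin{bmatrix} c_{\ell,1} \\ c_{\ell,2} \end{bmatrix}.$$ If $\hat H$ is an $\mathcal{H}_2\otimes\mathcal{L}_2$-optimal reduced-order model for $H$, then for $\ell=1,2,\dots,r$, $$\mathcal{H}(-\overline{\lambda_\ell})\,\mathfrak{b}_\ell=\hat{\mathcal{H}}(-\overline{\lambda_\ell})\,\mathfrak{b}_\ell,$$ $$\mathfrak{c}_\ell^*\,\mathcal{H}(-\overline{\lambda_\ell})=\mathfrak{c}_\ell^*\,\hat{\mathcal{H}}(-\overline{\lambda_\ell}),$$ $$\mathfrak{c}_\ell^*\,\mathcal{H}'(-\overline{\lambda_\ell})\,\mathfrak{b}_\ell=\mathfrak{c}_\ell^*\,\hat{\mathcal{H}}'(-\overline{\lambda_\ell})\,\mathfrak{b}_\ell.$$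
   Context: Notation: $e_\ell$ is the $\ell$th standard basis vector of $\mathbb{C}^r$; $^*$ is the conjugate transpose; $\overline{\,\cdot\,}$ is complex conjugation; $I_m$ is the $m\times m$ identity; the prime denotes the derivative with respect to $s$. $\mathcal{H}_2$ is the Hardy space of matrix-valued functions analytic in the open right half-plane, with norm $\|F\|_{\mathcal{H}_2}=\bigl(\frac{1}{2\pi}\int_{-\infty}^{\infty}\|F(\boldsymbol{i}\omega)\|_{\rm F}^2\,d\omega\bigr)^{1/2}$, and $$\|H\|_{\mathcal{H}_2\otimes\mathcal{L}_2}=\Bigl(\int_{\mathcal{Q}}\|H(\cdot,q)\|_{\mathcal{H}_2}^2\,d\nu(q)\Bigr)^{1/2}.$$ $\hat H$ is an $\mathcal{H}_2\otimes\mathcal{L}_2$-optimal reduced-order model for $H$ if $(\hat A,\hat B_1,\hat B_2,\hat C_1,\hat C_2)$ is a (local) minimizer of $\|H-\hat H\|_{\mathcal{H}_2\otimes\mathcal{L}_2}$ over all reduced-order models of the same form and order $r$, i.e. over diagonal $\hat A\in\mathbb{C}^{r\times r}$, $\hat B_1,\hat B_2\in\mathbb{C}^{r\times n_{\rm i}}$, $\hat C_1,\hat C_2\in\mathbb{C}^{n_{\rm o}\times r}$. The transfer functions $H_{ij}$ need not be rational. *)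

theory Defs
  imports "HOL-Analysis.Analysis"
begin

section \<open>Matrices\<close>

text \<open>
  A complex \<open>m \<times> n\<close> matrix is a term of type \<^typ>\<open>complex ^ 'n ^ 'm\<close>. The library norm on this type is
  the Frobenius norm:
\<close>

lemma norm_matrix_eq_Frobenius:
  fixes A :: "complex ^ 'n ^ 'm"
  shows "norm A = sqrt (\<Sum>i\<in>UNIV. \<Sum>j\<in>UNIV. (cmod (A $ i $ j))\<^sup>2)"
  by (simp add: norm_vec_def L2_set_def sum_nonneg)

definition diag_matrix :: "complex ^ 'r \<Rightarrow> complex ^ 'r ^ 'r" where
  "diag_matrix d = (\<chi> i j. if i = j then d $ i else 0)"

definition conj_transpose :: "complex ^ 'n ^ 'm \<Rightarrow> complex ^ 'm ^ 'n" where
  "conj_transpose A = (\<chi> i j. cnj (A $ j $ i))"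

text \<open>For a column vector \<open>c\<close>, the row vector \<open>c\<^sup>*\<close>; products \<open>c\<^sup>* A\<close> are then written with \<open>v*\<close>.\<close>

definition conj_vec :: "complex ^ 'n \<Rightarrow> complex ^ 'n" where
  "conj_vec c = (\<chi> i. cnj (c $ i))"

text \<open>The scalar product of a row vector and a column vector (no conjugation).\<close>

definition row_times_col :: "complex ^ 'n \<Rightarrow> complex ^ 'n \<Rightarrow> complex" where
  "row_times_col x y = (\<Sum>i\<in>UNIV. x $ i * y $ i)"

text \<open>Block matrices are indexed by sum types, \<^const>\<open>Inl\<close> being the first block and \<^const>\<open>Inr\<close> the second.\<close>

definition block_matrix ::
  "complex ^ 'n1 ^ 'm1 \<Rightarrow> complex ^ 'n2 ^ 'm1 \<Rightarrow> complex ^ 'n1 ^ 'm2 \<Rightarrow> complex ^ 'n2 ^ 'm2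
    \<Rightarrow> complex ^ ('n1 + 'n2) ^ ('m1 + 'm2)" where
  "block_matrix A11 A12 A21 A22 =
    (\<chi> i j. case i of
        Inl k \<Rightarrow> (case j of Inl l \<Rightarrow> A11 $ k $ l | Inr l \<Rightarrow> A12 $ k $ l)
      | Inr k \<Rightarrow> (case j of Inl l \<Rightarrow> A21 $ k $ l | Inr l \<Rightarrow> A22 $ k $ l))"

definition stack_rows ::
  "complex ^ 'n ^ 'm1 \<Rightarrow> complex ^ 'n ^ 'm2 \<Rightarrow> complex ^ 'n ^ ('m1 + 'm2)" where
  "stack_rows A1 A2 = (\<chi> i j. case i of Inl k \<Rightarrow> A1 $ k $ j | Inr k \<Rightarrow> A2 $ k $ j)"

definition append_cols ::
  "complex ^ 'n1 ^ 'm \<Rightarrow> complex ^ 'n2 ^ 'm \<Rightarrow> complex ^ ('n1 + 'n2) ^ 'm" where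
  "append_cols A1 A2 = (\<chi> i j. case j of Inl l \<Rightarrow> A1 $ i $ l | Inr l \<Rightarrow> A2 $ i $ l)"

definition stack_vec :: "complex ^ 'n1 \<Rightarrow> complex ^ 'n2 \<Rightarrow> complex ^ ('n1 + 'n2)" where
  "stack_vec x y = (\<chi> i. case i of Inl k \<Rightarrow> x $ k | Inr k \<Rightarrow> y $ k)"

definition matrix_deriv :: "(complex \<Rightarrow> complex ^ 'n ^ 'm) \<Rightarrow> complex \<Rightarrow> complex ^ 'n ^ 'm" where
  "matrix_deriv F s = (\<chi> i j. deriv (\<lambda>z. F z $ i $ j) s)"


section \<open>Hardy space of the right half-plane\<close>

text \<open>
  An element of the Hardy space is analytic in the open right half-plane with uniformly bounded
  \<open>L\<^sub>2\<close> norms on vertical lines. The norm below evaluates it on the imaginary axis. As usual, the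
  values there are the boundary values, which exist almost everywhere by Fatou's theorem; the last
  clause expresses this convention. Since boundary values are only Lebesgue measurable in
  general, integrals are taken with respect to the completed measure \<^const>\<open>lebesgue\<close>.
\<close>

definition hardy_H2 :: "(complex \<Rightarrow> complex ^ 'n ^ 'm) set" where
  "hardy_H2 = {F.
     (\<forall>i j. (\<lambda>s. F s $ i $ j) holomorphic_on {s. 0 < Re s}) \<and>
     (SUP \<sigma>\<in>{0<..}. \<integral>\<^sup>+ \<omega>. ennreal ((norm (F (Complex \<sigma> \<omega>)))\<^sup>2) \<partial>lebesgue) < \<infinity> \<and>
     (AE \<omega> in lebesgue. ((\<lambda>\<sigma>. F (Complex \<sigma> \<omega>)) \<longlongrightarrow> F (\<i> * complex_of_real \<omega>)) (at_right 0))}"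

definition H2_norm :: "(complex \<Rightarrow> complex ^ 'n ^ 'm) \<Rightarrow> real" where
  "H2_norm F =
     sqrt (1 / (2 * pi) * (LINT \<omega>|lebesgue. (norm (F (\<i> * complex_of_real \<omega>)))\<^sup>2))"

definition param_square :: "(real \<times> real) set" where
  "param_square = {0..1} \<times> {0..1}"

definition H2L2_norm :: "(complex \<Rightarrow> real \<times> real \<Rightarrow> complex ^ 'n ^ 'm) \<Rightarrow> real" where
  "H2L2_norm H = sqrt (LINT q|lebesgue_on param_square. (H2_norm (\<lambda>s. H s q))\<^sup>2)"


section \<open>Parametric reduced-order models\<close>

text \<open>A model is the tuple of its matrices \<open>(A, B\<^sub>1, B\<^sub>2, C\<^sub>1, C\<^sub>2)\<close>.\<close>

type_synonym ('r, 'ni, 'no) rom =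
  "(complex ^ 'r ^ 'r) \<times> (complex ^ 'ni ^ 'r) \<times> (complex ^ 'ni ^ 'r) \<times>
   (complex ^ 'r ^ 'no) \<times> (complex ^ 'r ^ 'no)"

fun rom_transfer ::
  "('r::finite, 'ni::finite, 'no::finite) rom \<Rightarrow> complex \<Rightarrow> real \<times> real \<Rightarrow> complex ^ 'ni ^ 'no" where
  "rom_transfer (A, B1, B2, C1, C2) s (q1, q2) =
     (C1 + q2 *\<^sub>R C2) ** matrix_inv (mat s - A) ** (B1 + q1 *\<^sub>R B2)"

text \<open>
  Only models with all poles in the open left half-plane have their transfer function in the
  Hardy space for every choice of the remaining matrices.
\<close>

definition admissible_roms :: "('r::finite, 'ni::finite, 'no::finite) rom set" where
  "admissible_roms =
     {(diag_matrix d, B1, B2, C1, C2) | d B1 B2 C1 C2. \<forall>k. Re (d $ k) < 0}"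

text \<open>
  Local minimality. The admissible models are relatively open in the set of all tuples with
  diagonal \<open>A\<close>, so it is immaterial whether competitors are taken from the former or the latter.
  A global minimizer is in particular a local one.
\<close>

definition H2L2_optimal ::
  "(complex \<Rightarrow> real \<times> real \<Rightarrow> complex ^ 'ni ^ 'no)
    \<Rightarrow> ('r::finite, 'ni::finite, 'no::finite) rom \<Rightarrow> bool" where
  "H2L2_optimal H R \<longleftrightarrow>
     R \<in> admissible_roms \<and>
     (\<exists>\<epsilon>>0. \<forall>R'\<in>admissible_roms. dist R' R < \<epsilon> \<longrightarrow>
        H2L2_norm (\<lambda>s q. H s q - rom_transfer R s q) \<le> H2L2_norm (\<lambda>s q. H s q - rom_transfer R' s q))"

end

theory Submission
  imports Defs "HOL-Complex_Analysis.Cauchy_Integral_Formula" "HOL-Probability.Sinc_Integral"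
begin

text \<open>
  The squared error is a squared Hilbert space norm, so at a local minimizer \<open>R\<close> with error
  \<open>E = H - R\<close> every admissible change \<open>D\<close> of the reduced transfer function satisfies
  \<open>2 \<langle>E, D\<rangle> \<le> \<parallel>D\<parallel>\<^sup>2\<close> (\<open>optimality_variation\<close>). The three families of conditions
  are the first-order consequences for three kinds of changes.

  What makes these consequences explicit is that \<open>s \<mapsto> V / (s - p)\<close> with \<open>Re p < 0\<close> is, for the
  \<open>H\<^sub>2\<close> inner product, a reproducing kernel: Cauchy's formula for the half-plane reads
  \<open>\<langle>F, V / (\<cdot> - p)\<rangle> = F (- cnj p) \<bullet> V\<close>, where \<open>\<bullet>\<close> is the real Frobenius inner product
  (\<open>hardy_H2_reproduced\<close>). The model in pole-residue form is a sum of such kernels with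
  residues \<open>c b\<^sup>*\<close>, whose factors are affine in the parameters. Integrating the monomials over the
  parameter square turns the \<open>H\<^sub>2 \<otimes> L\<^sub>2\<close> inner product into an \<open>H\<^sub>2\<close> inner product of the
  coefficients, weighted in each parameter by the Gram matrix of \<open>1, q\<close> in \<open>L\<^sub>2[0,1]\<close>, that is
  by \<open>(1, 1/2; 1/2, 1/3)\<close>. Applied to the vectors of the residues, this
  matrix produces \<open>\<bb>\<close> and \<open>\<cc>\<close>, and one finds
  \<open>\<langle>E, c b\<^sup>* / (\<cdot> - p)\<rangle> = Re (\<cc>\<^sup>* \<E>(- cnj p) \<bb>)\<close> with the block error \<open>\<E>\<close>
  (\<open>tensor_inner_cauchy_kernel\<close>).

  Changing the \<open>l\<close>-th rows of the input matrices gives \<open>Re (\<cc>\<^sup>* \<E>(- cnj p) v) = 0\<close> for all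
  \<open>v\<close>, since the Gram matrix is invertible; this is left interpolation. Changing columns of the output
  matrices gives right interpolation in the same way. Moving the pole \<open>p\<close> to \<open>p + t\<close> changes the
  model by a difference of two kernels, of norm \<open>O(\<bar>t\<bar>)\<close>, so that with
  \<open>e(s) = \<cc>\<^sup>* \<E>(s) \<bb>\<close> the inequality becomes \<open>Re (e(- cnj p - cnj t) - e(- cnj p)) \<le> K \<bar>t\<bar>\<^sup>2\<close>,
  which forces \<open>e' (- cnj p) = 0\<close>; this is the derivative condition.

  The analytic part is Cauchy's formula in terms of boundary values that are merely almost
  everywhere limits. On a vertical line inside the half-plane it follows from rectangles
  (\<open>cauchy_formula_vertical_line\<close>), and it extends to the imaginary axis because sequences that are bounded
  in \<open>L\<^sub>2\<close> and converge almost everywhere converge weakly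
  (\<open>weak_convergence_of_bounded_L2_AE_limit\<close>).
\<close>

section \<open>Weak convergence in the space of square integrable functions\<close>

lemma integrable_mult_L2:
  fixes f g :: "'a \<Rightarrow> complex"
  assumes [measurable]: "f \<in> borel_measurable M" "g \<in> borel_measurable M"
    and f: "integrable M (\<lambda>x. (cmod (f x))\<^sup>2)" and g: "integrable M (\<lambda>x. (cmod (g x))\<^sup>2)"
  shows "integrable M (\<lambda>x. f x * g x)"
proof (rule Bochner_Integration.integrable_bound)
  show "integrable M (\<lambda>x. (cmod (f x))\<^sup>2 + (cmod (g x))\<^sup>2)" using f g by simp
  show "AE x in M. norm (f x * g x) \<le> norm ((cmod (f x))\<^sup>2 + (cmod (g x))\<^sup>2)"
  proof (rule AE_I2)
    fix x
    have "0 \<le> (cmod (f x) - cmod (g x))\<^sup>2" by simp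
    then have "2 * (cmod (f x) * cmod (g x)) \<le> (cmod (f x))\<^sup>2 + (cmod (g x))\<^sup>2"
      by (simp add: power2_eq_square algebra_simps)
    moreover have "0 \<le> cmod (f x) * cmod (g x)" by simp
    ultimately show "norm (f x * g x) \<le> norm ((cmod (f x))\<^sup>2 + (cmod (g x))\<^sup>2)"
      unfolding norm_mult real_norm_def by linarith
  qed
qed simp

lemma cmod_diff_square_le: "(cmod (a - b))\<^sup>2 \<le> 2 * (cmod a)\<^sup>2 + 2 * (cmod b)\<^sup>2"
proof -
  have "(cmod (a - b))\<^sup>2 \<le> (cmod a + cmod b)\<^sup>2"
    by (intro power_mono norm_triangle_ineq4) auto
  also have "\<dots> \<le> 2 * (cmod a)\<^sup>2 + 2 * (cmod b)\<^sup>2"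
    using zero_le_power2[of "cmod a - cmod b"] by (simp add: power2_eq_square algebra_simps)
  finally show ?thesis .
qed

text \<open>
  Fatou's lemma. With a constant sequence this also turns a bound on a Lebesgue integral of
  nonnegative extended reals into integrability together with a bound on the Bochner integral.
\<close>

lemma bounded_L2_AE_limit:
  fixes f :: "nat \<Rightarrow> 'a \<Rightarrow> complex"
  assumes [measurable]: "\<And>n. f n \<in> borel_measurable M" "F \<in> borel_measurable M"
    and lim: "AE x in M. (\<lambda>n. f n x) \<longlonglongrightarrow> F x"
    and bound: "\<And>n. (\<integral>\<^sup>+ x. ennreal ((cmod (f n x))\<^sup>2) \<partial>M) \<le> ennreal C" and C: "0 \<le> C"
  shows "\<And>n. integrable M (\<lambda>x. (cmod (f n x))\<^sup>2)" "\<And>n. (\<integral>x. (cmod (f n x))\<^sup>2 \<partial>M) \<le> C"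
    and "integrable M (\<lambda>x. (cmod (F x))\<^sup>2)" "(\<integral>x. (cmod (F x))\<^sup>2 \<partial>M) \<le> C"
proof -
  have *: "integrable M (\<lambda>x. (cmod (h x))\<^sup>2) \<and> (\<integral>x. (cmod (h x))\<^sup>2 \<partial>M) \<le> C"
    if [measurable]: "h \<in> borel_measurable M" and h: "(\<integral>\<^sup>+ x. ennreal ((cmod (h x))\<^sup>2) \<partial>M) \<le> ennreal C" for h
  proof -
    have i: "integrable M (\<lambda>x. (cmod (h x))\<^sup>2)"
      by (rule integrableI_bounded) (use h in \<open>auto simp: le_less_trans\<close>)
    have "ennreal (\<integral>x. (cmod (h x))\<^sup>2 \<partial>M) \<le> ennreal C"
      using h by (subst nn_integral_eq_integral[symmetric, OF i]) auto
    then show ?thesis using i C by (simp add: ennreal_le_iff)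
  qed
  show "integrable M (\<lambda>x. (cmod (f n x))\<^sup>2)" "(\<integral>x. (cmod (f n x))\<^sup>2 \<partial>M) \<le> C" for n
    using *[of "f n"] bound by auto
  have "(\<integral>\<^sup>+ x. ennreal ((cmod (F x))\<^sup>2) \<partial>M) = (\<integral>\<^sup>+ x. liminf (\<lambda>n. ennreal ((cmod (f n x))\<^sup>2)) \<partial>M)"
  proof (rule nn_integral_cong_AE)
    show "AE x in M. ennreal ((cmod (F x))\<^sup>2) = liminf (\<lambda>n. ennreal ((cmod (f n x))\<^sup>2))"
      using lim
    proof eventually_elim
      case (elim x)
      then have "(\<lambda>n. ennreal ((cmod (f n x))\<^sup>2)) \<longlonglongrightarrow> ennreal ((cmod (F x))\<^sup>2)"
        by (intro tendsto_intros)
      then show ?case by (intro lim_imp_Liminf[symmetric] trivial_limit_sequentially)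
    qed
  qed
  also have "\<dots> \<le> liminf (\<lambda>n. \<integral>\<^sup>+ x. ennreal ((cmod (f n x))\<^sup>2) \<partial>M)"
    by (rule nn_integral_liminf) simp
  also have "\<dots> \<le> ennreal C"
    by (rule Liminf_le) (auto simp: bound)
  finally show "integrable M (\<lambda>x. (cmod (F x))\<^sup>2)" "(\<integral>x. (cmod (F x))\<^sup>2 \<partial>M) \<le> C"
    using *[of F] by auto
qed

text \<open>
  Write \<open>h\<close> for \<open>f n - F\<close>. Where \<open>\<bar>h\<bar> \<le> K \<bar>g\<bar>\<close> the integrand \<open>\<bar>h g\<bar>\<close> is dominated by
  \<open>K \<bar>g\<bar>\<^sup>2\<close>, so dominated convergence applies; elsewhere it is at most
  \<open>\<bar>h\<bar>\<^sup>2 / K\<close>, whose integral is at most \<open>4 C / K\<close>. Finally \<open>K\<close> is taken large.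
\<close>

lemma weak_convergence_of_bounded_L2_AE_limit:
  fixes f :: "nat \<Rightarrow> 'a \<Rightarrow> complex"
  assumes [measurable]: "\<And>n. f n \<in> borel_measurable M" "F \<in> borel_measurable M" "g \<in> borel_measurable M"
    and lim: "AE x in M. (\<lambda>n. f n x) \<longlonglongrightarrow> F x"
    and bound: "\<And>n. (\<integral>\<^sup>+ x. ennreal ((cmod (f n x))\<^sup>2) \<partial>M) \<le> ennreal C" and C: "0 \<le> C"
    and g: "integrable M (\<lambda>x. (cmod (g x))\<^sup>2)"
  shows "(\<lambda>n. \<integral>x. f n x * g x \<partial>M) \<longlonglongrightarrow> (\<integral>x. F x * g x \<partial>M)"
proof -
  note L2 = bounded_L2_AE_limit[OF assms(1,2) lim bound C]
  define h where "h n x = f n x - F x" for n x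
  have [measurable]: "h n \<in> borel_measurable M" for n unfolding h_def by simp
  have h2: "integrable M (\<lambda>x. (cmod (h n x))\<^sup>2)" for n
    by (rule Bochner_Integration.integrable_bound[of M "\<lambda>x. 2 * (cmod (f n x))\<^sup>2 + 2 * (cmod (F x))\<^sup>2"])
       (use L2(1,3) in \<open>auto simp: h_def intro!: AE_I2 cmod_diff_square_le\<close>)
  have h4: "(\<integral>x. (cmod (h n x))\<^sup>2 \<partial>M) \<le> 4 * C" for n
  proof -
    have "(\<integral>x. (cmod (h n x))\<^sup>2 \<partial>M) \<le> (\<integral>x. 2 * (cmod (f n x))\<^sup>2 + 2 * (cmod (F x))\<^sup>2 \<partial>M)"
      by (rule integral_mono) (use L2(1,3) h2 in \<open>auto simp: h_def intro!: cmod_diff_square_le\<close>)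
    also have "\<dots> = 2 * (\<integral>x. (cmod (f n x))\<^sup>2 \<partial>M) + 2 * (\<integral>x. (cmod (F x))\<^sup>2 \<partial>M)"
      using L2(1,3) by simp
    also have "\<dots> \<le> 4 * C" using L2(2)[of n] L2(4) by simp
    finally show ?thesis .
  qed
  define m where "m K n x = min (cmod (h n x) * cmod (g x)) (K * (cmod (g x))\<^sup>2)" for K :: real and n x
  have m_meas [measurable]: "m K n \<in> borel_measurable M" for K n unfolding m_def by simp
  have m_bound: "norm (m K n x) \<le> K * (cmod (g x))\<^sup>2" if "0 < K" for K n x
    using that by (auto simp: m_def min_def abs_mult)
  have m_int: "integrable M (m K n)" if "0 < K" for K n
    by (rule Bochner_Integration.integrable_bound[of M "\<lambda>x. K * (cmod (g x))\<^sup>2"])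
       (use g m_bound[OF that] that in \<open>auto intro!: AE_I2\<close>)
  have m_lim: "(\<lambda>n. \<integral>x. m K n x \<partial>M) \<longlonglongrightarrow> 0" if K: "0 < K" for K
  proof -
    have "(\<lambda>n. \<integral>x. m K n x \<partial>M) \<longlonglongrightarrow> (\<integral>x. 0 \<partial>M)"
    proof (rule integral_dominated_convergence[where w="\<lambda>x. K * (cmod (g x))\<^sup>2"])
      show "AE x in M. (\<lambda>n. m K n x) \<longlonglongrightarrow> 0"
        using lim
      proof eventually_elim
        case (elim x)
        then have "(\<lambda>n. h n x) \<longlonglongrightarrow> F x - F x" unfolding h_def by (intro tendsto_intros)
        then have "(\<lambda>n. m K n x) \<longlonglongrightarrow> min (cmod 0 * cmod (g x)) (K * (cmod (g x))\<^sup>2)"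
          unfolding m_def by (intro tendsto_intros) simp
        then show ?case using K by (simp add: min_def split: if_splits)
      qed
    qed (use g m_bound[OF K] in auto)
    then show ?thesis by simp
  qed
  have hg_int: "integrable M (\<lambda>x. h n x * g x)" for n
    by (rule integrable_mult_L2) (use h2 g in auto)
  have key: "cmod (\<integral>x. h n x * g x \<partial>M) \<le> (\<integral>x. m K n x \<partial>M) + 4 * C / K" if K: "0 < K" for K n
  proof -
    have "cmod (\<integral>x. h n x * g x \<partial>M) \<le> (\<integral>x. cmod (h n x * g x) \<partial>M)"
      by (rule integral_norm_bound)
    also have "\<dots> \<le> (\<integral>x. m K n x + (cmod (h n x))\<^sup>2 / K \<partial>M)"
    proof (rule integral_mono)
      fix x
      show "cmod (h n x * g x) \<le> m K n x + (cmod (h n x))\<^sup>2 / K"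
      proof (cases "cmod (h n x) \<le> K * cmod (g x)")
        case True
        then have "cmod (h n x) * cmod (g x) \<le> K * (cmod (g x))\<^sup>2"
          by (simp add: power2_eq_square mult_right_mono flip: mult.assoc)
        then show ?thesis using K by (simp add: m_def norm_mult)
      next
        case False
        then have "cmod (g x) \<le> cmod (h n x) / K" using K by (simp add: field_simps)
        then have "cmod (h n x) * cmod (g x) \<le> cmod (h n x) * (cmod (h n x) / K)"
          by (intro mult_left_mono) auto
        moreover have "0 \<le> m K n x" using K by (simp add: m_def)
        ultimately show ?thesis by (simp add: norm_mult power2_eq_square)
      qed
    qed (use hg_int h2 m_int[OF K] in auto)
    also have "\<dots> = (\<integral>x. m K n x \<partial>M) + (\<integral>x. (cmod (h n x))\<^sup>2 \<partial>M) / K"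
      using h2 m_int[OF K] by simp
    also have "\<dots> \<le> (\<integral>x. m K n x \<partial>M) + 4 * C / K"
      using h4[of n] K by (simp add: divide_right_mono)
    finally show ?thesis .
  qed
  have "(\<lambda>n. \<integral>x. h n x * g x \<partial>M) \<longlonglongrightarrow> 0"
  proof (rule LIMSEQ_I)
    fix r :: real assume r: "0 < r"
    define K where "K = 8 * C / r + 1"
    have K: "0 < K" using r C by (simp add: K_def add_nonneg_pos)
    have "4 * C / K < r / 2 \<or> C = 0"
      using r C K by (auto simp: K_def field_simps)
    then have CK: "4 * C / K < r / 2" using r by auto
    obtain N where N: "\<And>n. n \<ge> N \<Longrightarrow> norm ((\<integral>x. m K n x \<partial>M) - 0) < r / 2"
      using LIMSEQ_D[OF m_lim[OF K], of "r/2"] r by auto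
    show "\<exists>N. \<forall>n\<ge>N. norm ((\<integral>x. h n x * g x \<partial>M) - 0) < r"
    proof (intro exI allI impI)
      fix n assume "n \<ge> N"
      then show "norm ((\<integral>x. h n x * g x \<partial>M) - 0) < r"
        using N[of n] key[OF K, of n] CK by simp
    qed
  qed
  moreover have "(\<integral>x. h n x * g x \<partial>M) = (\<integral>x. f n x * g x \<partial>M) - (\<integral>x. F x * g x \<partial>M)" for n
    unfolding h_def left_diff_distrib
    by (rule Bochner_Integration.integral_diff) (use L2 g in \<open>auto intro: integrable_mult_L2\<close>)
  ultimately show ?thesis by (simp add: LIM_zero_iff)
qed

section \<open>Cauchy's formula on vertical lines\<close>

lemma contour_integral_linepath_same_Im:
  assumes "a < b"
  shows "contour_integral (linepath (Complex a t) (Complex b t)) f = integral {a..b} (\<lambda>x. f (Complex x t))"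
proof -
  have "contour_integral (linepath (Complex a t) (Complex b t)) f
      = contour_integral (linepath (of_real a) (of_real b)) (\<lambda>z. f (z + Complex 0 t))"
  proof -
    have "linepath (Complex a t) (Complex b t) x = linepath (of_real a) (of_real b) x + Complex 0 t" for x
      by (auto simp: linepath_def complex_eq_iff algebra_simps)
    moreover have "Complex b t - Complex a t = of_real b - of_real a"
      by (simp add: complex_eq_iff)
    ultimately show ?thesis by (simp add: contour_integral_integral)
  qed
  also have "\<dots> = integral {a..b} (\<lambda>x. f (of_real x + Complex 0 t))"
    using assms by (subst contour_integral_linepath_Reals_eq) auto
  also have "(\<lambda>x. f (of_real x + Complex 0 t)) = (\<lambda>x. f (Complex x t))"
    by (rule ext, rule arg_cong[where f=f]) (simp add: complex_eq_iff)
  finally show ?thesis .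
qed

text \<open>
  Cauchy's formula on the rectangle with real parts in \<open>[a, b]\<close> and imaginary parts in \<open>[-T, T]\<close>,
  with the left side isolated. The right side keeps its kernel, because its decay in \<open>b\<close> will be
  needed in mean square; on the horizontal sides the kernel is bounded by the inverse distance to \<open>\<mu>\<close>.
\<close>

lemma cauchy_rectangle_estimate:
  fixes f :: "complex \<Rightarrow> complex"
  assumes hol: "f holomorphic_on {s. 0 < Re s}"
    and a: "0 < a" "a < Re \<mu>" and b: "Re \<mu> < b" and T: "\<bar>Im \<mu>\<bar> < T"
  shows "cmod (integral {-T..T} (\<lambda>\<omega>. f (Complex a \<omega>) / (\<mu> - Complex a \<omega>)) - 2 * pi * f \<mu>)
     \<le> integral {-T..T} (\<lambda>\<omega>. cmod (f (Complex b \<omega>)) / cmod (\<mu> - Complex b \<omega>))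
       + integral {a..b} (\<lambda>x. cmod (f (Complex x T))) / (T - \<bar>Im \<mu>\<bar>)
       + integral {a..b} (\<lambda>x. cmod (f (Complex x (-T)))) / (T - \<bar>Im \<mu>\<bar>)"
proof -
  define k where "k w = f w / (w - \<mu>)" for w
  define p where "p = Complex a (-T)"
  define q where "q = Complex b T"
  have T0: "0 < T" using T by linarith
  have ab: "a < b" using a b by linarith
  have box: "\<mu> \<in> box p q"
    using a b T by (auto simp: p_def q_def in_box_complex_iff)
  have img: "path_image (rectpath p q) = {z. Re z \<in> {a,b} \<and> Im z \<in> {-T..T}} \<union> {z. Im z \<in> {-T,T} \<and> Re z \<in> {a..b}}"
    using T0 ab by (subst path_image_rectpath) (auto simp: p_def q_def)
  have "(k has_contour_integral (2*pi * \<i> * winding_number (rectpath p q) \<mu> * f \<mu>)) (rectpath p q)"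
    unfolding k_def
  proof (rule Cauchy_integral_formula_convex_simple[of "{s. 0 < Re s}"])
    show "convex {s. 0 < Re s}" by (rule convex_halfspace_Re_gt)
    show "\<mu> \<in> interior {s. 0 < Re s}"
      using a by (simp add: interior_open open_halfspace_Re_gt)
    show "path_image (rectpath p q) \<subseteq> {s. 0 < Re s} - {\<mu>}"
      using a b T unfolding img by auto
  qed (use hol in auto)
  then have C: "(k has_contour_integral (2*pi * \<i> * f \<mu>)) (rectpath p q)"
    using winding_number_rectpath[OF box] by simp
  have holk: "continuous_on {s. 0 < Re s \<and> s \<noteq> \<mu>} k"
    unfolding k_def
    by (intro continuous_intros continuous_on_subset[OF holomorphic_on_imp_continuous_on[OF hol]]) auto
  have conts: "continuous_on S (\<lambda>x. k (Complex (u x) (v x)))"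
    if "continuous_on S u" "continuous_on S v" "\<And>x. x \<in> S \<Longrightarrow> 0 < u x \<and> Complex (u x) (v x) \<noteq> \<mu>" for S and u v :: "real \<Rightarrow> real"
    by (rule continuous_on_compose2[OF holk]) (use that in \<open>auto intro!: continuous_intros\<close>)
  have contf: "continuous_on {s. 0 < Re s} f" by (rule holomorphic_on_imp_continuous_on[OF hol])
  have fconts: "continuous_on S (\<lambda>x. f (Complex (u x) (v x)))"
    if "continuous_on S u" "continuous_on S v" "\<And>x. x \<in> S \<Longrightarrow> 0 < u x" for S and u v :: "real \<Rightarrow> real"
    by (rule continuous_on_compose2[OF contf, where f="\<lambda>x. Complex (u x) (v x)"])
       (use that in \<open>auto intro!: continuous_intros\<close>)
  define q' where "q' = Complex b (-T)"
  define p' where "p' = Complex a T"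
  have seg: "k contour_integrable_on linepath x y" if "closed_segment x y \<subseteq> path_image (rectpath p q)" for x y
  proof (rule contour_integrable_continuous_linepath)
    have "path_image (rectpath p q) \<subseteq> {s. 0 < Re s \<and> s \<noteq> \<mu>}"
      using a b T unfolding img by auto
    then show "continuous_on (closed_segment x y) k" using that by (intro continuous_on_subset[OF holk]) blast
  qed
  have i1: "k contour_integrable_on linepath p q'" and i2: "k contour_integrable_on linepath q' q"
    and i3: "k contour_integrable_on linepath q p'" and i4: "k contour_integrable_on linepath p' p"
    using T0 ab by (auto intro!: seg simp: img[unfolded p_def q_def] p_def q_def p'_def q'_def closed_segment_same_Re closed_segment_same_Im
        closed_segment_eq_real_ivl)
  have "2*pi * \<i> * f \<mu> = contour_integral (rectpath p q) k"
    using C by (simp add: contour_integral_unique)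
  also have "\<dots> = contour_integral (linepath p q') k + (contour_integral (linepath q' q) k
       + (contour_integral (linepath q p') k + contour_integral (linepath p' p) k))"
    unfolding rectpath_def Let_def using i1 i2 i3 i4
    by (simp add: p_def q_def p'_def q'_def)
  also have "contour_integral (linepath q p') k = - contour_integral (linepath p' q) k"
    by (rule contour_integral_reverse_linepath, rule continuous_on_subset[OF holk])
       (use a b T ab in \<open>auto simp: p'_def q_def closed_segment_same_Im closed_segment_eq_real_ivl\<close>)
  also have "contour_integral (linepath p' p) k = - contour_integral (linepath p p') k"
    by (rule contour_integral_reverse_linepath, rule continuous_on_subset[OF holk])
       (use a b T T0 in \<open>auto simp: p'_def p_def closed_segment_same_Re closed_segment_eq_real_ivl\<close>)
  finally have E1: "2*pi * \<i> * f \<mu> = contour_integral (linepath p q') k + (contour_integral (linepath q' q) k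
       + (- contour_integral (linepath p' q) k + - contour_integral (linepath p p') k))" .
  define L where "L c = integral {-T..T} (\<lambda>\<omega>. f (Complex c \<omega>) / (\<mu> - Complex c \<omega>))" for c
  define S where "S t = integral {a..b} (\<lambda>x. k (Complex x t))" for t
  have kneg: "integral {-T..T} (\<lambda>\<omega>. k (Complex c \<omega>)) = - L c" for c
    unfolding L_def k_def integral_neg[symmetric]
    by (intro Henstock_Kurzweil_Integration.integral_cong) (metis minus_diff_eq minus_divide_right)
  have vert: "contour_integral (linepath (Complex c (-T)) (Complex c T)) k = - \<i> * L c" for c
    using T0 by (subst contour_integral_linepath_same_Re[of _ c _ "-T" T]) (auto simp: kneg)
  have hor: "contour_integral (linepath (Complex a t) (Complex b t)) k = S t" for t
    unfolding S_def by (rule contour_integral_linepath_same_Im[OF ab])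
  have "2*pi * \<i> * f \<mu> = S (-T) + (- \<i> * L b + (- S T + \<i> * L a))"
    using E1 unfolding p_def q_def p'_def q'_def vert hor by simp
  then have "\<i> * (L a - 2*pi * f \<mu>) = \<i> * L b + S T - S (-T)"
    by (simp add: algebra_simps)
  then have "cmod (\<i> * (L a - 2*pi * f \<mu>)) = cmod (\<i> * L b + S T - S (-T))" by simp
  also have "\<dots> \<le> cmod (L b) + cmod (S T) + cmod (S (-T))"
    using norm_triangle_ineq4[of "\<i> * L b + S T" "S (-T)"] norm_triangle_ineq[of "\<i> * L b" "S T"]
    by (simp add: norm_mult)
  finally have main: "cmod (L a - 2*pi * f \<mu>) \<le> cmod (L b) + cmod (S T) + cmod (S (-T))"
    by (simp add: norm_mult)
  have Lb: "cmod (L b) \<le> integral {-T..T} (\<lambda>\<omega>. cmod (f (Complex b \<omega>)) / cmod (\<mu> - Complex b \<omega>))"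
    unfolding L_def
    by (rule integral_norm_bound_integral)
       (use a b in \<open>auto intro!: integrable_continuous_real continuous_intros fconts simp: norm_divide complex_eq_iff\<close>)
  have Sb: "cmod (S t) \<le> integral {a..b} (\<lambda>x. cmod (f (Complex x t))) / (T - \<bar>Im \<mu>\<bar>)" if t: "\<bar>t\<bar> = T" for t
  proof -
    have ne: "Complex x t \<noteq> \<mu>" for x using t T by auto
    have "cmod (S t) \<le> integral {a..b} (\<lambda>x. cmod (f (Complex x t)) * inverse (T - \<bar>Im \<mu>\<bar>))"
      unfolding S_def
    proof (rule integral_norm_bound_integral)
      show "(\<lambda>x. k (Complex x t)) integrable_on {a..b}"
        by (intro integrable_continuous_real conts continuous_intros) (use a ne in auto)
      show "(\<lambda>x. cmod (f (Complex x t)) * inverse (T - \<bar>Im \<mu>\<bar>)) integrable_on {a..b}"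
        by (intro integrable_continuous_real fconts continuous_intros) (use a in auto)
      show "cmod (k (Complex x t)) \<le> cmod (f (Complex x t)) * inverse (T - \<bar>Im \<mu>\<bar>)" for x
      proof -
        have "T - \<bar>Im \<mu>\<bar> \<le> \<bar>Im (Complex x t - \<mu>)\<bar>" using t by auto
        also have "\<dots> \<le> cmod (Complex x t - \<mu>)" by (rule abs_Im_le_cmod)
        finally show ?thesis using T
          unfolding k_def divide_inverse norm_mult norm_inverse
          by (intro mult_left_mono le_imp_inverse_le) auto
      qed
    qed
    then show ?thesis by (simp add: divide_inverse)
  qed
  show ?thesis
    using main Lb Sb[of T] Sb[of "-T"] T0 unfolding L_def by simp
qed

text \<open>
  Horizontal sides of a rectangle cannot be estimated at every height, since only vertical lines are
  controlled. By Fubini the average over heights in \<open>[h, h + 1]\<close> of the two horizontal integrals is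
  at most \<open>2 C (b - a)\<close>, so some height does it. Adding \<open>1\<close> to
  the bound makes it a strict one.
\<close>

lemma exists_height_small_L2:
  fixes f :: "complex \<Rightarrow> complex"
  assumes cont: "continuous_on {s. 0 < Re s} f"
    and bound: "\<And>\<sigma>. 0 < \<sigma> \<Longrightarrow> (\<integral>\<^sup>+ \<omega>. ennreal ((cmod (f (Complex \<sigma> \<omega>)))\<^sup>2) \<partial>lborel) \<le> ennreal C"
    and C: "0 \<le> C" and ab: "0 < a" "a < b"
  shows "\<exists>T\<in>{h..h+1}. integral {a..b} (\<lambda>x. (cmod (f (Complex x T)))\<^sup>2) + integral {a..b} (\<lambda>x. (cmod (f (Complex x (-T))))\<^sup>2)
           \<le> 2 * C * (b - a) + 1"
proof (rule ccontr)
  assume neg: "\<not> ?thesis"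
  define K where "K = 2 * C * (b - a) + 1"
  have K: "0 < K" using C ab by (simp add: K_def add_nonneg_pos)
  \<comment> \<open>The truncation \<open>F\<close> makes the integrand measurable on the whole plane.\<close>
  define F where "F = (\<lambda>z. indicat_real {s. 0 < Re s} z *\<^sub>R f z)"
  have [measurable]: "F \<in> borel_measurable borel"
    unfolding F_def using cont by (intro borel_measurable_continuous_on_indicator) (auto intro: borel_open open_halfspace_Re_gt)
  have [measurable]: "(\<lambda>p. Complex (fst p) (snd p)) \<in> borel_measurable (borel \<Otimes>\<^sub>M borel)"
    unfolding borel_prod by (intro borel_measurable_continuous_onI continuous_intros)
  define G where "G x t = ennreal ((cmod (F (Complex x t)))\<^sup>2 + (cmod (F (Complex x (-t))))\<^sup>2)" for x t
  have Gm [measurable]: "(\<lambda>(x,t). G x t) \<in> borel_measurable (borel \<Otimes>\<^sub>M borel)"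
  proof -
    have "(\<lambda>p. F (Complex (fst p) (snd p))) \<in> borel_measurable (borel \<Otimes>\<^sub>M borel)"
      by (rule measurable_compose[where g=F]) measurable
    moreover have "(\<lambda>p. F (Complex (fst p) (snd p))) \<circ> (\<lambda>p. (fst p, - snd p)) \<in> borel_measurable (borel \<Otimes>\<^sub>M borel)"
      by (rule measurable_comp[OF _ calculation]) measurable
    ultimately show ?thesis unfolding G_def split_beta o_def by simp
  qed
  have F_eq: "F (Complex x t) = f (Complex x t)" if "x \<in> {a..b}" for x t
    using that ab by (simp add: F_def)
  have sq: "continuous_on {a..b} (\<lambda>x. (cmod (f (Complex x t)))\<^sup>2)" for t
    by (intro continuous_intros continuous_on_compose2[OF cont, where f="\<lambda>x. Complex x t"]) (use ab in auto)
  have hor: "ennreal K \<le> (\<integral>\<^sup>+ x. G x t * indicator {a..b} x \<partial>lborel)" if t: "t \<in> {h..h+1}" for t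
  proof -
    let ?g = "\<lambda>x. (cmod (f (Complex x t)))\<^sup>2 + (cmod (f (Complex x (-t))))\<^sup>2"
    have "K < integral {a..b} (\<lambda>x. (cmod (f (Complex x t)))\<^sup>2) + integral {a..b} (\<lambda>x. (cmod (f (Complex x (-t))))\<^sup>2)"
      using neg t unfolding K_def by (metis not_le)
    also have "\<dots> = integral {a..b} ?g"
      by (rule Henstock_Kurzweil_Integration.integral_add[symmetric]) (intro integrable_continuous_real sq)+
    finally have "ennreal K \<le> ennreal (integral {a..b} ?g)"
      using K by (simp add: ennreal_leI)
    also have "\<dots> = (\<integral>\<^sup>+ x. ennreal (?g x) * indicator {a..b} x \<partial>lborel)"
    proof (rule nn_integral_has_integral_lebesgue'[symmetric])
      show "(?g has_integral integral {a..b} ?g) {a..b}"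
        by (intro integrable_integral integrable_continuous_real continuous_on_add sq)
    qed auto
    also have "\<dots> = (\<integral>\<^sup>+ x. G x t * indicator {a..b} x \<partial>lborel)"
      by (intro nn_integral_cong) (auto simp: G_def F_eq indicator_def)
    finally show ?thesis .
  qed
  have ver: "(\<integral>\<^sup>+ t. G x t \<partial>lborel) \<le> ennreal (2 * C)" if x: "x \<in> {a..b}" for x
  proof -
    have [measurable]: "(\<lambda>t. F (Complex x t)) \<in> borel_measurable borel"
      by (rule measurable_compose[where g=F and N=borel]) (auto intro!: borel_measurable_continuous_onI continuous_intros)
    have [measurable]: "(\<lambda>t. F (Complex x (-t))) \<in> borel_measurable borel"
      by (rule measurable_compose[where g=F and N=borel]) (auto intro!: borel_measurable_continuous_onI continuous_intros)
    have 1: "(\<integral>\<^sup>+ t. ennreal ((cmod (F (Complex x t)))\<^sup>2) \<partial>lborel) \<le> ennreal C"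
      using bound[of x] x ab by (simp add: F_eq)
    have 2: "(\<integral>\<^sup>+ t. ennreal ((cmod (F (Complex x (-t))))\<^sup>2) \<partial>lborel) = (\<integral>\<^sup>+ t. ennreal ((cmod (F (Complex x t)))\<^sup>2) \<partial>lborel)"
      by (subst (2) nn_integral_real_affine[where c="-1" and t=0]) auto
    have "(\<integral>\<^sup>+ t. G x t \<partial>lborel) = (\<integral>\<^sup>+ t. ennreal ((cmod (F (Complex x t)))\<^sup>2) \<partial>lborel) + (\<integral>\<^sup>+ t. ennreal ((cmod (F (Complex x (-t))))\<^sup>2) \<partial>lborel)"
      unfolding G_def by (subst nn_integral_add[symmetric]) auto
    also have "\<dots> \<le> ennreal C + ennreal C" unfolding 2 by (intro add_mono 1)
    finally show ?thesis using C by (simp flip: ennreal_plus)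
  qed
  have "ennreal K = (\<integral>\<^sup>+ t. ennreal K * indicator {h..h+1} t \<partial>lborel)"
    by (simp add: nn_integral_cmult_indicator)
  also have "\<dots> \<le> (\<integral>\<^sup>+ t. (\<integral>\<^sup>+ x. G x t * indicator {a..b} x \<partial>lborel) \<partial>lborel)"
    by (intro nn_integral_mono) (auto simp: indicator_def intro: order_trans[OF hor])
  also have "\<dots> = (\<integral>\<^sup>+ x. (\<integral>\<^sup>+ t. G x t * indicator {a..b} x \<partial>lborel) \<partial>lborel)"
    by (rule lborel_pair.Fubini') (use Gm in measurable)
  also have "\<dots> \<le> (\<integral>\<^sup>+ x. ennreal (2 * C) * indicator {a..b} x \<partial>lborel)"
    by (intro nn_integral_mono) (auto simp: indicator_def intro: ver)
  also have "\<dots> = ennreal (2 * C * (b - a))"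
    using ab C by (simp add: nn_integral_cmult_indicator ennreal_mult)
  finally show False using C ab by (simp add: K_def ennreal_le_iff)
qed

text \<open>
  The substitution \<open>\<omega> = Im z + x Re z\<close> reduces the integral to that of \<open>1 / (1 + x\<^sup>2)\<close>. The
  bound is stated for the decay in \<open>\<bar>Re z\<bar>\<close>, the distance of \<open>z\<close> from the line.
\<close>

lemma nn_integral_cauchy_kernel:
  "\<exists>c::real. 0 < c \<and> (\<forall>z::complex. Re z \<noteq> 0 \<longrightarrow>
     (\<integral>\<^sup>+ \<omega>. ennreal (1 / (cmod (z - Complex 0 \<omega>))\<^sup>2) \<partial>lborel) \<le> ennreal (c / \<bar>Re z\<bar>))"
proof -
  have i: "integrable lborel (\<lambda>x::real. inverse (1 + x\<^sup>2))"
    using integrable_inverse_1_plus_square by (simp add: set_integrable_def)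
  define c where "c = (\<integral>x. inverse (1 + (x::real)\<^sup>2) \<partial>lborel) + 1"
  have c0: "0 \<le> (\<integral>x. inverse (1 + (x::real)\<^sup>2) \<partial>lborel)" by (rule integral_nonneg_AE) auto
  have "(\<integral>\<^sup>+ \<omega>. ennreal (1 / (cmod (z - Complex 0 \<omega>))\<^sup>2) \<partial>lborel) \<le> ennreal (c / \<bar>Re z\<bar>)" if z: "Re z \<noteq> 0" for z
  proof -
    have "(\<integral>\<^sup>+ \<omega>. ennreal (1 / (cmod (z - Complex 0 \<omega>))\<^sup>2) \<partial>lborel)
      = ennreal \<bar>Re z\<bar> * (\<integral>\<^sup>+ x. ennreal (1 / (cmod (z - Complex 0 (Im z + Re z * x)))\<^sup>2) \<partial>lborel)"
      using z by (subst nn_integral_real_affine[where c="Re z" and t="Im z"]) (auto simp: cmod_power2)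
    also have "\<dots> = ennreal \<bar>Re z\<bar> * (\<integral>\<^sup>+ x. ennreal (1 / (Re z)\<^sup>2) * ennreal (inverse (1 + x\<^sup>2)) \<partial>lborel)"
    proof (intro arg_cong2[where f="(*)"] nn_integral_cong refl)
      fix x
      have "(cmod (z - Complex 0 (Im z + Re z * x)))\<^sup>2 = (Re z)\<^sup>2 * (1 + x\<^sup>2)"
        unfolding cmod_power2 by (simp add: power2_eq_square algebra_simps)
      then show "ennreal (1 / (cmod (z - Complex 0 (Im z + Re z * x)))\<^sup>2) = ennreal (1 / (Re z)\<^sup>2) * ennreal (inverse (1 + x\<^sup>2))"
        by (simp add: divide_inverse flip: ennreal_mult)
    qed
    also have "\<dots> = ennreal \<bar>Re z\<bar> * (ennreal (1 / (Re z)\<^sup>2) * ennreal (\<integral>x. inverse (1 + x\<^sup>2) \<partial>lborel))"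
      using i by (subst nn_integral_cmult) (auto simp: nn_integral_eq_integral)
    also have "\<dots> = ennreal ((\<integral>x. inverse (1 + x\<^sup>2) \<partial>lborel) / \<bar>Re z\<bar>)"
      using z c0 by (simp add: power2_eq_square field_simps flip: ennreal_mult)
    also have "\<dots> \<le> ennreal (c / \<bar>Re z\<bar>)"
      by (intro ennreal_leI divide_right_mono) (auto simp: c_def)
    finally show ?thesis .
  qed
  moreover have "0 < c" using c0 by (simp add: c_def add_nonneg_pos)
  ultimately show ?thesis by blast
qed

text \<open>
  Rectangles whose right side is at \<open>b n = Re \<mu> + n + 1\<close> and whose height is at least \<open>(b n)\<^sup>2\<close>.
  The height must grow faster than the width: the integral over a horizontal side grows
  with the width, while the kernel there is bounded by the inverse height.
\<close>

lemma cauchy_formula_vertical_line: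
  fixes f :: "complex \<Rightarrow> complex"
  assumes hol: "f holomorphic_on {s. 0 < Re s}"
    and bound: "\<And>\<sigma>. 0 < \<sigma> \<Longrightarrow> (\<integral>\<^sup>+ \<omega>. ennreal ((cmod (f (Complex \<sigma> \<omega>)))\<^sup>2) \<partial>lborel) \<le> ennreal C"
    and C: "0 \<le> C" and a: "0 < a" "a < Re \<mu>"
  shows "(\<integral>\<omega>. f (Complex a \<omega>) / (\<mu> - Complex a \<omega>) \<partial>lborel) = 2 * pi * f \<mu>"
proof -
  have cont: "continuous_on {s. 0 < Re s} f" by (rule holomorphic_on_imp_continuous_on[OF hol])
  obtain c :: real where c: "0 < c" and ker: "\<And>z. Re z \<noteq> 0 \<Longrightarrow>
     (\<integral>\<^sup>+ \<omega>. ennreal (1 / (cmod (z - Complex 0 \<omega>))\<^sup>2) \<partial>lborel) \<le> ennreal (c / \<bar>Re z\<bar>)"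
    using nn_integral_cauchy_kernel by blast
  have fline: "continuous_on S (\<lambda>\<omega>. f (Complex x \<omega>))" if "0 < x" for x and S
    by (rule continuous_on_compose2[OF cont, where f="\<lambda>\<omega>. Complex x \<omega>"]) (use that in \<open>auto intro!: continuous_intros\<close>)
  have L2: "integrable lborel (\<lambda>\<omega>. (cmod (f (Complex x \<omega>)))\<^sup>2) \<and> (\<integral>\<omega>. (cmod (f (Complex x \<omega>)))\<^sup>2 \<partial>lborel) \<le> C" 
     if x: "0 < x" for x
  proof -
    have [measurable]: "(\<lambda>\<omega>. f (Complex x \<omega>)) \<in> borel_measurable lborel"
      using fline[OF x] by (simp add: borel_measurable_continuous_onI)
    show ?thesis
      using bounded_L2_AE_limit(3,4)[of "\<lambda>_ \<omega>. f (Complex x \<omega>)" lborel "\<lambda>\<omega>. f (Complex x \<omega>)" C] bound[OF x] C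
      by auto
  qed
  have K2: "integrable lborel (\<lambda>\<omega>. (cmod (1 / (\<mu> - Complex x \<omega>)))\<^sup>2) \<and> (\<integral>\<omega>. (cmod (1 / (\<mu> - Complex x \<omega>)))\<^sup>2 \<partial>lborel) \<le> c / \<bar>Re \<mu> - x\<bar>"
    if x: "x \<noteq> Re \<mu>" for x
  proof -
    have ne: "\<mu> - Complex x \<omega> \<noteq> 0" for \<omega> using x by (auto simp: complex_eq_iff)
    have m: "(\<lambda>\<omega>. 1 / (\<mu> - Complex x \<omega>)) \<in> borel_measurable lborel"
      using ne by (auto intro!: borel_measurable_continuous_onI continuous_intros)
    have eq: "\<mu> - Complex x \<omega> = (\<mu> - of_real x) - Complex 0 \<omega>" for \<omega> by (simp add: complex_eq_iff)
    show ?thesis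
      using bounded_L2_AE_limit(3,4)[of "\<lambda>_ \<omega>. 1 / (\<mu> - Complex x \<omega>)" lborel "\<lambda>\<omega>. 1 / (\<mu> - Complex x \<omega>)" "c / \<bar>Re \<mu> - x\<bar>"] 
        ker[of "\<mu> - of_real x"] c x m
      by (auto simp: norm_divide power_divide eq)
  qed
  have fk: "integrable lborel (\<lambda>\<omega>. f (Complex x \<omega>) / (\<mu> - Complex x \<omega>))" if x: "0 < x" "x \<noteq> Re \<mu>" for x
  proof -
    have ne: "\<mu> - Complex x \<omega> \<noteq> 0" for \<omega> using x by (auto simp: complex_eq_iff)
    have "integrable lborel (\<lambda>\<omega>. f (Complex x \<omega>) * (1 / (\<mu> - Complex x \<omega>)))"
      by (rule integrable_mult_L2)
       (use L2[OF x(1)] K2[OF x(2)] fline[OF x(1)] ne in \<open>auto intro!: borel_measurable_continuous_onI continuous_intros\<close>)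
    then show ?thesis by simp
  qed
  define b where "b n = Re \<mu> + real (Suc n)" for n
  have "\<forall>n. \<exists>T\<in>{\<bar>Im \<mu>\<bar> + (b n)\<^sup>2..(\<bar>Im \<mu>\<bar> + (b n)\<^sup>2)+1}. integral {a..b n} (\<lambda>x. (cmod (f (Complex x T)))\<^sup>2) + integral {a..b n} (\<lambda>x. (cmod (f (Complex x (-T))))\<^sup>2)
           \<le> 2 * C * (b n - a) + 1"
    by (intro allI exists_height_small_L2[OF cont bound C a(1)]) (use a in \<open>auto simp: b_def\<close>)
  then obtain T where T: "\<And>n. T n \<ge> \<bar>Im \<mu>\<bar> + (b n)\<^sup>2"
    and TC: "\<And>n. integral {a..b n} (\<lambda>x. (cmod (f (Complex x (T n))))\<^sup>2) + integral {a..b n} (\<lambda>x. (cmod (f (Complex x (-T n))))\<^sup>2)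
           \<le> 2 * C * (b n - a) + 1"
    by (metis atLeastAtMost_iff)
  have b0: "0 < b n" "a < b n" "Re \<mu> < b n" "real n + 1 \<le> b n" for n using a by (auto simp: b_def)
  have Tpos: "\<bar>Im \<mu>\<bar> < T n" for n using T[of n] b0(1)[of n] by (smt (verit) zero_less_power)
  have T0: "0 < T n" for n using Tpos[of n] by linarith
  define L where "L n = integral {-T n..T n} (\<lambda>\<omega>. f (Complex a \<omega>) / (\<mu> - Complex a \<omega>))" for n
  \<comment> \<open>Horizontal sides: total mean square \<open>O(b n)\<close>, kernel \<open>O(1 / (b n)\<^sup>2)\<close>.\<close>
  have hor: "integral {a..b n} (\<lambda>x. cmod (f (Complex x (T n)))) / (T n - \<bar>Im \<mu>\<bar>)
       + integral {a..b n} (\<lambda>x. cmod (f (Complex x (-T n)))) / (T n - \<bar>Im \<mu>\<bar>) \<le> (2 + 2 * C) / b n + 1 / (b n)\<^sup>2" for n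
  proof -
    let ?I = "\<lambda>t. integral {a..b n} (\<lambda>x. cmod (f (Complex x t)))"
    let ?J = "\<lambda>t. integral {a..b n} (\<lambda>x. (cmod (f (Complex x t)))\<^sup>2)"
    have ct: "continuous_on {a..b n} (\<lambda>x. f (Complex x t))" for t
      by (rule continuous_on_compose2[OF cont, where f="\<lambda>x. Complex x t"]) (use a in \<open>auto intro!: continuous_intros\<close>)
    have le: "?I t \<le> (b n - a) + ?J t" for t
    proof -
      have "?I t \<le> integral {a..b n} (\<lambda>x. 1 + (cmod (f (Complex x t)))\<^sup>2)"
      proof (rule integral_le)
        show "cmod (f (Complex x t)) \<le> 1 + (cmod (f (Complex x t)))\<^sup>2" for x
          using zero_le_power2[of "cmod (f (Complex x t)) - 1"] norm_ge_zero[of "f (Complex x t)"]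
          unfolding power2_diff power_one mult_1_right by linarith
      qed (intro integrable_continuous_real continuous_intros ct)+
      also have "\<dots> = integral {a..b n} (\<lambda>x. 1) + ?J t"
        by (rule Henstock_Kurzweil_Integration.integral_add) (intro integrable_continuous_real continuous_intros ct)+
      finally show ?thesis using b0[of n] by simp
    qed
    have nonneg: "0 \<le> ?I t" for t by (rule integral_nonneg) (auto intro!: integrable_continuous_real continuous_intros ct)
    have "?I (T n) + ?I (-T n) \<le> 2 * (b n - a) + (2 * C * (b n - a) + 1)"
      using le[of "T n"] le[of "-T n"] TC[of n] by simp
    also have "\<dots> \<le> (2 + 2 * C) * b n + 1" 
      using a C by (simp add: algebra_simps)
    finally have s: "?I (T n) + ?I (-T n) \<le> (2 + 2 * C) * b n + 1" .
    have "?I (T n) / (T n - \<bar>Im \<mu>\<bar>) + ?I (-T n) / (T n - \<bar>Im \<mu>\<bar>) = (?I (T n) + ?I (-T n)) / (T n - \<bar>Im \<mu>\<bar>)"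
      by (simp add: add_divide_distrib)
    also have "\<dots> \<le> (?I (T n) + ?I (-T n)) / (b n)\<^sup>2"
      using T[of n] Tpos[of n] b0[of n] nonneg[of "T n"] nonneg[of "-T n"]
      by (intro divide_left_mono mult_pos_pos) auto
    also have "\<dots> \<le> ((2 + 2 * C) * b n + 1) / (b n)\<^sup>2" using s by (intro divide_right_mono) auto
    also have "\<dots> = (2 + 2 * C) / b n + 1 / (b n)\<^sup>2" using b0(1)[of n] by (simp add: field_simps power2_eq_square)
    finally show ?thesis .
  qed
  \<comment> \<open>Right side: \<open>u v \<le> u\<^sup>2 / e + e v\<^sup>2\<close>, with \<open>e\<close> balancing the bounded mean square of \<open>f\<close>
    against that of the kernel, which is \<open>O(1 / e\<^sup>2)\<close>.\<close>
  have right: "integral {-T n..T n} (\<lambda>\<omega>. cmod (f (Complex (b n) \<omega>)) / cmod (\<mu> - Complex (b n) \<omega>))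
      \<le> (C + c) / sqrt (real n + 1)" for n
  proof -
    define e where "e = sqrt (real n + 1)"
    have e: "0 < e" "e * e = real n + 1" by (auto simp: e_def)
    let ?h = "\<lambda>\<omega>. (cmod (f (Complex (b n) \<omega>)))\<^sup>2 / e + e * (cmod (1 / (\<mu> - Complex (b n) \<omega>)))\<^sup>2"
    have ne: "\<mu> \<noteq> Complex (b n) \<omega>" for \<omega> using b0(3)[of n] by (auto simp: complex_eq_iff)
    have bb: "b n \<noteq> Re \<mu>" using b0(3)[of n] by simp
    have hi: "integrable lborel ?h" using L2[OF b0(1)] K2[OF bb] by simp
    have "integral {-T n..T n} (\<lambda>\<omega>. cmod (f (Complex (b n) \<omega>)) / cmod (\<mu> - Complex (b n) \<omega>)) \<le> integral {-T n..T n} ?h"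
    proof (rule integral_le)
      fix \<omega>
      define u where "u = cmod (f (Complex (b n) \<omega>))"
      define v where "v = cmod (1 / (\<mu> - Complex (b n) \<omega>))"
      have uv: "0 \<le> u" "0 \<le> v" by (auto simp: u_def v_def)
      have "0 \<le> (u - e * v)\<^sup>2 / e" using e by simp
      also have "\<dots> = u\<^sup>2 / e + e * v\<^sup>2 - 2 * (u * v)" using e(1) by (simp add: field_simps power2_eq_square)
      finally have "u * v \<le> u\<^sup>2 / e + e * v\<^sup>2" using mult_nonneg_nonneg[OF uv] by linarith
      then show "cmod (f (Complex (b n) \<omega>)) / cmod (\<mu> - Complex (b n) \<omega>) \<le> ?h \<omega>"
        by (simp add: u_def v_def norm_divide)
    next
      show "?h integrable_on {-T n..T n}"
        using e(1) ne by (intro integrable_continuous_real continuous_intros fline[OF b0(1)]) auto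
    qed (use ne in \<open>auto intro!: integrable_continuous_real continuous_intros fline[OF b0(1)]\<close>)
    also have "\<dots> \<le> integral UNIV ?h"
      by (rule integral_subset_le)
       (use e(1) ne in \<open>auto intro!: integrable_continuous_real continuous_intros fline[OF b0(1)] integrable_on_lborel hi\<close>)
    also have "\<dots> = (\<integral>\<omega>. ?h \<omega> \<partial>lborel)" using integral_lborel[OF hi] by simp
    also have "\<dots> = (\<integral>\<omega>. (cmod (f (Complex (b n) \<omega>)))\<^sup>2 \<partial>lborel) / e + e * (\<integral>\<omega>. (cmod (1 / (\<mu> - Complex (b n) \<omega>)))\<^sup>2 \<partial>lborel)"
      using L2[OF b0(1)] K2[OF bb] by simp
    also have "\<dots> \<le> C / e + e * (c / \<bar>Re \<mu> - b n\<bar>)"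
      using L2[OF b0(1)] K2[OF bb] e by (intro add_mono divide_right_mono mult_left_mono) auto
    also have "\<bar>Re \<mu> - b n\<bar> = e * e" unfolding e(2) by (simp add: b_def)
    also have "C / e + e * (c / (e * e)) = (C + c) / e" using e(1) by (simp add: field_simps)
    finally show ?thesis by (simp add: e_def)
  qed
  have est: "cmod (L n - 2 * pi * f \<mu>) \<le> (C + c) / sqrt (real n + 1) + ((2 + 2 * C) / b n + 1 / (b n)\<^sup>2)" for n
    using cauchy_rectangle_estimate[OF hol a b0(3)[of n] Tpos[of n]] right[of n] hor[of n] unfolding L_def by linarith
  have blim: "filterlim b at_top sequentially"
    by (rule filterlim_at_top_mono[OF filterlim_real_sequentially]) (use b0(4) in \<open>auto intro!: always_eventually order_trans[OF _ b0(4)]\<close>)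
  have sqlim: "filterlim (\<lambda>n. sqrt (real n + 1)) at_top sequentially"
    by (rule filterlim_compose[OF sqrt_at_top]) (rule filterlim_at_top_mono[OF filterlim_real_sequentially], auto)
  have tail0: "(\<lambda>n. (C + c) / sqrt (real n + 1) + ((2 + 2 * C) / b n + 1 / (b n)\<^sup>2)) \<longlonglongrightarrow> 0 + (0 + 0)"
    by (intro tendsto_add tendsto_divide_0[OF tendsto_const] filterlim_at_top_imp_at_infinity sqlim blim
        filterlim_pow_at_top) auto
  have "(\<lambda>n. L n - 2 * pi * f \<mu>) \<longlonglongrightarrow> 0"
    by (rule Lim_null_comparison[where g="\<lambda>n. (C + c) / sqrt (real n + 1) + ((2 + 2 * C) / b n + 1 / (b n)\<^sup>2)"])
       (use est tail0 in auto)
  then have lim1: "L \<longlonglongrightarrow> 2 * pi * f \<mu>" by (simp add: LIM_zero_iff)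
  have Tlim: "filterlim T at_top sequentially"
  proof (rule filterlim_at_top_mono[OF blim], intro always_eventually allI)
    fix n
    have "b n * 1 \<le> b n * b n" using b0(1,4)[of n] by (intro mult_left_mono) auto
    then show "b n \<le> T n" using T[of n] by (simp add: power2_eq_square)
  qed
  let ?g = "\<lambda>\<omega>. f (Complex a \<omega>) / (\<mu> - Complex a \<omega>)"
  have gi: "integrable lborel ?g" using fk[of a] a by auto
  have "(\<lambda>n. \<integral>\<omega>. indicator {-T n..T n} \<omega> *\<^sub>R ?g \<omega> \<partial>lborel) \<longlonglongrightarrow> (\<integral>\<omega>. ?g \<omega> \<partial>lborel)"
  proof (rule integral_dominated_convergence[where w="\<lambda>\<omega>. cmod (?g \<omega>)"])
    show "AE \<omega> in lborel. (\<lambda>n. indicator {-T n..T n} \<omega> *\<^sub>R ?g \<omega>) \<longlonglongrightarrow> ?g \<omega>"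
    proof (intro AE_I2 tendsto_eventually)
      fix \<omega>
      have "\<forall>\<^sub>F n in sequentially. \<bar>\<omega>\<bar> \<le> T n" using Tlim by (simp add: filterlim_at_top)
      then show "\<forall>\<^sub>F n in sequentially. indicator {-T n..T n} \<omega> *\<^sub>R ?g \<omega> = ?g \<omega>"
        by eventually_elim (auto simp: indicator_def)
    qed
  qed (use gi in \<open>auto simp: indicator_def\<close>)
  also have "(\<lambda>n. \<integral>\<omega>. indicator {-T n..T n} \<omega> *\<^sub>R ?g \<omega> \<partial>lborel) = L"
  proof
    fix n
    have "set_integrable lborel {-T n..T n} ?g"
      using gi unfolding set_integrable_def by (intro integrable_mult_indicator) auto
    from set_borel_integral_eq_integral(2)[OF this]
    show "(\<integral>\<omega>. indicator {-T n..T n} \<omega> *\<^sub>R ?g \<omega> \<partial>lborel) = L n"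
      by (simp add: L_def set_lebesgue_integral_def)
  qed
  finally show ?thesis using lim1 LIMSEQ_unique by blast
qed

section \<open>Cauchy's formula for boundary values\<close>

text \<open>
  Shifting \<open>\<mu>\<close> by \<open>\<sigma>\<close> along with the line keeps the kernel fixed, so that letting \<open>\<sigma>\<close> tend to \<open>0\<close>
  only requires weak convergence of \<open>f(\<sigma> + \<i> \<omega>)\<close> against one square integrable function.
\<close>

lemma cauchy_formula_boundary_values:
  fixes f :: "complex \<Rightarrow> complex"
  assumes hol: "f holomorphic_on {s. 0 < Re s}"
    and bound: "\<And>\<sigma>. 0 < \<sigma> \<Longrightarrow> (\<integral>\<^sup>+ \<omega>. ennreal ((cmod (f (Complex \<sigma> \<omega>)))\<^sup>2) \<partial>lborel) \<le> ennreal C"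
    and C: "0 \<le> C"
    and lim: "AE \<omega> in lebesgue. ((\<lambda>\<sigma>. f (Complex \<sigma> \<omega>)) \<longlongrightarrow> f (\<i> * complex_of_real \<omega>)) (at_right 0)"
  shows "(\<lambda>\<omega>. f (\<i> * complex_of_real \<omega>)) \<in> borel_measurable lebesgue"
    and "integrable lebesgue (\<lambda>\<omega>. (cmod (f (\<i> * complex_of_real \<omega>)))\<^sup>2)"
    and "\<And>\<mu>. 0 < Re \<mu> \<Longrightarrow> integrable lebesgue (\<lambda>\<omega>. f (\<i> * complex_of_real \<omega>) / (\<mu> - \<i> * complex_of_real \<omega>))"
    and "\<And>\<mu>. 0 < Re \<mu> \<Longrightarrow>
      (\<integral>\<omega>. f (\<i> * complex_of_real \<omega>) / (\<mu> - \<i> * complex_of_real \<omega>) \<partial>lebesgue) = 2 * pi * f \<mu>"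
proof -
  have cont: "continuous_on {s. 0 < Re s} f" by (rule holomorphic_on_imp_continuous_on[OF hol])
  define \<sigma> where "\<sigma> n = inverse (real (Suc n))" for n
  have \<sigma>: "0 < \<sigma> n" for n by (simp add: \<sigma>_def)
  have \<sigma>0: "\<sigma> \<longlonglongrightarrow> 0" unfolding \<sigma>_def by (rule LIMSEQ_inverse_real_of_nat)
  have \<sigma>r: "filterlim \<sigma> (at_right 0) sequentially"
    using \<sigma>0 \<sigma> by (auto simp: filterlim_at less_imp_neq[OF \<sigma>, symmetric])
  let ?fn = "\<lambda>n \<omega>. f (Complex (\<sigma> n) \<omega>)"
  let ?F = "\<lambda>\<omega>. f (\<i> * complex_of_real \<omega>)"
  have fn_borel: "?fn n \<in> borel_measurable borel" for n
    by (intro borel_measurable_continuous_onI continuous_on_compose2[OF cont, where f="\<lambda>\<omega>. Complex (\<sigma> n) \<omega>"])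
       (use \<sigma> in \<open>auto intro!: continuous_intros\<close>)
  have fn_meas: "?fn n \<in> borel_measurable lebesgue" for n
    using fn_borel[of n] by (intro measurable_completion) simp
  have seq: "AE \<omega> in lebesgue. (\<lambda>n. ?fn n \<omega>) \<longlonglongrightarrow> ?F \<omega>"
    using lim by eventually_elim (rule filterlim_compose[OF _ \<sigma>r])
  show F_meas: "?F \<in> borel_measurable lebesgue"
  proof (rule borel_measurable_AE)
    show "(\<lambda>\<omega>. lim (\<lambda>n. ?fn n \<omega>)) \<in> borel_measurable lebesgue"
      using fn_meas by (rule borel_measurable_lim_metric)
    show "AE \<omega> in lebesgue. lim (\<lambda>n. ?fn n \<omega>) = ?F \<omega>"
      using seq by eventually_elim (rule limI)
  qed
  have bd: "(\<integral>\<^sup>+ \<omega>. ennreal ((cmod (?fn n \<omega>))\<^sup>2) \<partial>lebesgue) \<le> ennreal C" for n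
    using bound[OF \<sigma>[of n]] by (simp add: nn_integral_completion)
  show F2: "integrable lebesgue (\<lambda>\<omega>. (cmod (?F \<omega>))\<^sup>2)"
    by (rule bounded_L2_AE_limit(3)[OF fn_meas F_meas seq bd C])
  fix \<mu> :: complex assume \<mu>: "0 < Re \<mu>"
  let ?g = "\<lambda>\<omega>. 1 / (\<mu> - \<i> * complex_of_real \<omega>)"
  have ne: "\<mu> - \<i> * complex_of_real \<omega> \<noteq> 0" for \<omega> using \<mu> by (auto simp: complex_eq_iff)
  have g_borel: "?g \<in> borel_measurable borel"
    using ne by (auto intro!: borel_measurable_continuous_onI continuous_intros)
  have g_meas: "?g \<in> borel_measurable lebesgue"
    using g_borel by (intro measurable_completion) simp
  obtain c :: real where "0 < c" and ker: "\<And>z. Re z \<noteq> 0 \<Longrightarrow>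
     (\<integral>\<^sup>+ \<omega>. ennreal (1 / (cmod (z - Complex 0 \<omega>))\<^sup>2) \<partial>lborel) \<le> ennreal (c / \<bar>Re z\<bar>)"
    using nn_integral_cauchy_kernel by blast
  have g2: "integrable lebesgue (\<lambda>\<omega>. (cmod (?g \<omega>))\<^sup>2)"
  proof (rule bounded_L2_AE_limit(3)[of "\<lambda>_. ?g"])
    show "(\<integral>\<^sup>+ \<omega>. ennreal ((cmod (?g \<omega>))\<^sup>2) \<partial>lebesgue) \<le> ennreal (c / \<bar>Re \<mu>\<bar>)" for n
      using ker[of \<mu>] \<mu> by (simp add: nn_integral_completion Complex_eq norm_divide power_divide)
  qed (use g_meas \<open>0 < c\<close> in auto)
  show "integrable lebesgue (\<lambda>\<omega>. ?F \<omega> / (\<mu> - \<i> * complex_of_real \<omega>))"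
    using integrable_mult_L2[OF F_meas g_meas F2 g2] by simp
  have "(\<lambda>n. \<integral>\<omega>. ?fn n \<omega> * ?g \<omega> \<partial>lebesgue) \<longlonglongrightarrow> (\<integral>\<omega>. ?F \<omega> * ?g \<omega> \<partial>lebesgue)"
    by (rule weak_convergence_of_bounded_L2_AE_limit[OF fn_meas F_meas g_meas seq bd C g2])
  moreover have "(\<integral>\<omega>. ?fn n \<omega> * ?g \<omega> \<partial>lebesgue) = 2 * pi * f (\<mu> + \<sigma> n)" for n
  proof -
    have "(\<integral>\<omega>. ?fn n \<omega> * ?g \<omega> \<partial>lebesgue) = (\<integral>\<omega>. ?fn n \<omega> * ?g \<omega> \<partial>lborel)"
      using fn_borel g_borel by (intro integral_completion) simp
    also have "\<dots> = (\<integral>\<omega>. f (Complex (\<sigma> n) \<omega>) / (\<mu> + \<sigma> n - Complex (\<sigma> n) \<omega>) \<partial>lborel)"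
      by (intro Bochner_Integration.integral_cong) (auto simp: Complex_eq)
    also have "\<dots> = 2 * pi * f (\<mu> + \<sigma> n)"
      by (rule cauchy_formula_vertical_line[OF hol bound C \<sigma>]) (use \<mu> in auto)
    finally show ?thesis .
  qed
  moreover have "(\<lambda>n. 2 * pi * f (\<mu> + \<sigma> n)) \<longlonglongrightarrow> 2 * pi * f (\<mu> + of_real 0)"
  proof (intro tendsto_intros isCont_tendsto_compose[where g=f] \<sigma>0)
    have "isCont f \<mu>"
      using cont \<mu> by (simp add: continuous_on_eq_continuous_at open_halfspace_Re_gt)
    then show "isCont f (\<mu> + of_real 0)" by simp
  qed
  ultimately show "(\<integral>\<omega>. ?F \<omega> / (\<mu> - \<i> * complex_of_real \<omega>) \<partial>lebesgue) = 2 * pi * f \<mu>"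
    by (simp add: LIMSEQ_unique)
qed

section \<open>Cauchy kernels as reproducing kernels\<close>

text \<open>
  Only values on the imaginary axis enter norms and inner products. Working with these functions
  rather than with the Hardy space allows transfer functions that agree on the
  axis to be exchanged, whatever they do at their poles.
\<close>

definition axis_L2 :: "(complex \<Rightarrow> complex ^ 'n ^ 'm) \<Rightarrow> bool" where
  "axis_L2 F \<longleftrightarrow> (\<lambda>\<omega>. F (\<i> * complex_of_real \<omega>)) \<in> borel_measurable lebesgue \<and>
     integrable lebesgue (\<lambda>\<omega>. (norm (F (\<i> * complex_of_real \<omega>)))\<^sup>2)"

definition H2_inner :: "(complex \<Rightarrow> complex ^ 'n ^ 'm) \<Rightarrow> (complex \<Rightarrow> complex ^ 'n ^ 'm) \<Rightarrow> real" where
  "H2_inner F G = 1 / (2 * pi) * (LINT \<omega>|lebesgue. F (\<i> * complex_of_real \<omega>) \<bullet> G (\<i> * complex_of_real \<omega>))"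

definition cauchy_kernel :: "complex \<Rightarrow> complex ^ 'n ^ 'm \<Rightarrow> complex \<Rightarrow> complex ^ 'n ^ 'm" where
  "cauchy_kernel p V s = (\<chi> i j. V $ i $ j / (s - p))"

text \<open>
  The functions for which Cauchy's formula holds as a statement about inner products. This
  class is a real vector space and contains both the Hardy space and the kernels
  themselves, hence every error of a model.
\<close>

definition reproduced :: "(complex \<Rightarrow> complex ^ 'n ^ 'm) \<Rightarrow> bool" where
  "reproduced F \<longleftrightarrow> (\<forall>i j. (\<lambda>s. F s $ i $ j) holomorphic_on {s. 0 < Re s}) \<and> axis_L2 F \<and>
     (\<forall>p V. Re p < 0 \<longrightarrow> H2_inner F (cauchy_kernel p V) = F (- cnj p) \<bullet> V)"

lemma axis_L2_inner_integrable:
  fixes F G :: "complex \<Rightarrow> complex ^ 'n ^ 'm"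
  assumes "axis_L2 F" "axis_L2 G"
  shows "integrable lebesgue (\<lambda>\<omega>. F (\<i> * complex_of_real \<omega>) \<bullet> G (\<i> * complex_of_real \<omega>))"
proof (rule Bochner_Integration.integrable_bound)
  let ?f = "\<lambda>\<omega>. F (\<i> * complex_of_real \<omega>)" and ?g = "\<lambda>\<omega>. G (\<i> * complex_of_real \<omega>)"
  show "integrable lebesgue (\<lambda>\<omega>. (norm (?f \<omega>))\<^sup>2 + (norm (?g \<omega>))\<^sup>2)"
    using assms by (simp add: axis_L2_def)
  show "(\<lambda>\<omega>. ?f \<omega> \<bullet> ?g \<omega>) \<in> borel_measurable lebesgue"
    using assms by (intro borel_measurable_inner) (auto simp: axis_L2_def)
  show "AE \<omega> in lebesgue. norm (?f \<omega> \<bullet> ?g \<omega>) \<le> norm ((norm (?f \<omega>))\<^sup>2 + (norm (?g \<omega>))\<^sup>2)"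
  proof (rule AE_I2)
    fix \<omega>
    have "\<bar>?f \<omega> \<bullet> ?g \<omega>\<bar> \<le> norm (?f \<omega>) * norm (?g \<omega>)" by (rule Cauchy_Schwarz_ineq2)
    moreover have "0 \<le> norm (?f \<omega>) * norm (?g \<omega>)" by simp
    moreover have "0 \<le> (norm (?f \<omega>))\<^sup>2 + (norm (?g \<omega>))\<^sup>2 - 2 * norm (?f \<omega>) * norm (?g \<omega>)"
      unfolding power2_diff[symmetric] by simp
    ultimately show "norm (?f \<omega> \<bullet> ?g \<omega>) \<le> norm ((norm (?f \<omega>))\<^sup>2 + (norm (?g \<omega>))\<^sup>2)"
      unfolding real_norm_def by linarith
  qed
qed

lemma axis_L2_add [intro]:
  fixes F G :: "complex \<Rightarrow> complex ^ 'n ^ 'm"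
  assumes F: "axis_L2 F" and G: "axis_L2 G" shows "axis_L2 (\<lambda>s. F s + G s)"
proof -
  have "integrable lebesgue (\<lambda>\<omega>. (norm (F (\<i> * complex_of_real \<omega>) + G (\<i> * complex_of_real \<omega>)))\<^sup>2)"
    using axis_L2_inner_integrable[OF F F] axis_L2_inner_integrable[OF F G]
      axis_L2_inner_integrable[OF G F] axis_L2_inner_integrable[OF G G]
    by (simp add: power2_norm_eq_inner inner_add)
  then show ?thesis using F G by (auto simp: axis_L2_def)
qed

lemma axis_L2_scaleR [intro]:
  fixes F :: "complex \<Rightarrow> complex ^ 'n ^ 'm"
  assumes "axis_L2 F" shows "axis_L2 (\<lambda>s. c *\<^sub>R F s)"
  using assms by (auto simp: axis_L2_def power_mult_distrib)

lemma H2_inner_commute: "H2_inner F G = H2_inner G F"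
  by (simp add: H2_inner_def inner_commute)

lemma H2_inner_add_left:
  assumes "axis_L2 F" "axis_L2 G" "axis_L2 K"
  shows "H2_inner (\<lambda>s. F s + G s) K = H2_inner F K + H2_inner G K"
  unfolding H2_inner_def inner_add_left
  by (subst Bochner_Integration.integral_add) (use assms axis_L2_inner_integrable in \<open>auto simp: algebra_simps\<close>)

lemma H2_inner_scaleR_left: "H2_inner (\<lambda>s. c *\<^sub>R F s) K = c * H2_inner F K"
  by (simp add: H2_inner_def)

lemma axis_L2_zero [intro]: "axis_L2 (\<lambda>s. 0)" by (simp add: axis_L2_def)

lemma H2_inner_zero_left [simp]: "H2_inner (\<lambda>s. 0) K = 0" by (simp add: H2_inner_def)

lemma axis_L2_sum:
  assumes "\<And>a. a \<in> A \<Longrightarrow> axis_L2 (F a)" shows "axis_L2 (\<lambda>s. \<Sum>a\<in>A. F a s)"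
  using assms by (induction A rule: infinite_finite_induct) auto

lemma H2_inner_sum_left:
  assumes "\<And>a. a \<in> A \<Longrightarrow> axis_L2 (F a)" "axis_L2 K"
  shows "H2_inner (\<lambda>s. \<Sum>a\<in>A. F a s) K = (\<Sum>a\<in>A. H2_inner (F a) K)"
  using assms by (induction A rule: infinite_finite_induct) (auto simp: H2_inner_add_left axis_L2_sum)

lemma H2_norm_power2: "(H2_norm F)\<^sup>2 = H2_inner F F"
proof -
  have "0 \<le> 1 / (2 * pi) * (LINT \<omega>|lebesgue. (norm (F (\<i> * complex_of_real \<omega>)))\<^sup>2)"
    by (intro mult_nonneg_nonneg integral_nonneg_AE) auto
  then show ?thesis by (simp add: H2_norm_def H2_inner_def power2_norm_eq_inner)
qed

lemma norm_matrix_scale: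
  fixes V :: "complex ^ 'n ^ 'm"
  shows "norm (\<chi> i j. k * V $ i $ j) = cmod k * norm V"
proof -
  have "norm (\<chi> i j. k * V $ i $ j) = sqrt ((cmod k)\<^sup>2 * (\<Sum>i\<in>UNIV. \<Sum>j\<in>UNIV. (cmod (V $ i $ j))\<^sup>2))"
    by (simp add: norm_matrix_eq_Frobenius norm_mult power_mult_distrib sum_distrib_left)
  then show ?thesis by (simp add: real_sqrt_mult norm_matrix_eq_Frobenius)
qed

lemma norm_cauchy_kernel: "norm (cauchy_kernel p V s) = norm V / cmod (s - p)"
  using norm_matrix_scale[of "1 / (s - p)" V] by (simp add: cauchy_kernel_def norm_divide)

lemma cauchy_kernel_hardy_H2:
  assumes p: "Re p < 0"
  shows "cauchy_kernel p V \<in> hardy_H2"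
proof -
  obtain c :: real where c: "0 < c" and ker: "\<And>z. Re z \<noteq> 0 \<Longrightarrow>
     (\<integral>\<^sup>+ \<omega>. ennreal (1 / (cmod (z - Complex 0 \<omega>))\<^sup>2) \<partial>lborel) \<le> ennreal (c / \<bar>Re z\<bar>)"
    using nn_integral_cauchy_kernel by blast
  have "(\<lambda>s. cauchy_kernel p V s $ i $ j) holomorphic_on {s. 0 < Re s}" for i j
    unfolding cauchy_kernel_def using p by (auto intro!: holomorphic_intros)
  moreover have "(SUP \<sigma>\<in>{0<..}. \<integral>\<^sup>+ \<omega>. ennreal ((norm (cauchy_kernel p V (Complex \<sigma> \<omega>)))\<^sup>2) \<partial>lebesgue) < \<infinity>"
  proof -
    have "(SUP \<sigma>\<in>{0<..}. \<integral>\<^sup>+ \<omega>. ennreal ((norm (cauchy_kernel p V (Complex \<sigma> \<omega>)))\<^sup>2) \<partial>lebesgue)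
        \<le> ennreal ((norm V)\<^sup>2) * ennreal (c / \<bar>Re p\<bar>)"
    proof (rule SUP_least)
      fix \<sigma> :: real assume \<sigma>: "\<sigma> \<in> {0<..}"
      have ne: "p - of_real \<sigma> - Complex 0 \<omega> \<noteq> 0" for \<omega> using p \<sigma> by (auto simp: complex_eq_iff)
      have m: "(\<lambda>\<omega>. ennreal (1 / (cmod (p - of_real \<sigma> - Complex 0 \<omega>))\<^sup>2)) \<in> borel_measurable lborel"
        using ne by (auto intro!: borel_measurable_continuous_onI continuous_intros)
      have "(\<integral>\<^sup>+ \<omega>. ennreal ((norm (cauchy_kernel p V (Complex \<sigma> \<omega>)))\<^sup>2) \<partial>lebesgue)
          = (\<integral>\<^sup>+ \<omega>. ennreal ((norm V)\<^sup>2) * ennreal (1 / (cmod (p - of_real \<sigma> - Complex 0 \<omega>))\<^sup>2) \<partial>lborel)"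
        unfolding nn_integral_completion
      proof (rule nn_integral_cong)
        fix \<omega>
        have "cmod (Complex \<sigma> \<omega> - p) = cmod (p - of_real \<sigma> - Complex 0 \<omega>)"
          by (subst norm_minus_commute) (simp add: Complex_eq algebra_simps)
        then show "ennreal ((norm (cauchy_kernel p V (Complex \<sigma> \<omega>)))\<^sup>2)
          = ennreal ((norm V)\<^sup>2) * ennreal (1 / (cmod (p - of_real \<sigma> - Complex 0 \<omega>))\<^sup>2)"
          by (simp add: norm_cauchy_kernel power_divide flip: ennreal_mult)
      qed
      also have "\<dots> = ennreal ((norm V)\<^sup>2) * (\<integral>\<^sup>+ \<omega>. ennreal (1 / (cmod (p - of_real \<sigma> - Complex 0 \<omega>))\<^sup>2) \<partial>lborel)"
        by (rule nn_integral_cmult[OF m])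
      also have "\<dots> \<le> ennreal ((norm V)\<^sup>2) * ennreal (c / \<bar>Re (p - of_real \<sigma>)\<bar>)"
        using p \<sigma> by (intro mult_left_mono ker) auto
      also have "\<dots> \<le> ennreal ((norm V)\<^sup>2) * ennreal (c / \<bar>Re p\<bar>)"
        using p \<sigma> c by (intro mult_left_mono ennreal_leI divide_left_mono mult_pos_pos) auto
      finally show "(\<integral>\<^sup>+ \<omega>. ennreal ((norm (cauchy_kernel p V (Complex \<sigma> \<omega>)))\<^sup>2) \<partial>lebesgue)
        \<le> ennreal ((norm V)\<^sup>2) * ennreal (c / \<bar>Re p\<bar>)" .
    qed
    also have "\<dots> < \<infinity>" by (simp add: ennreal_mult_less_top)
    finally show ?thesis .
  qed
  moreover have "((\<lambda>\<sigma>. cauchy_kernel p V (Complex \<sigma> \<omega>)) \<longlongrightarrow> cauchy_kernel p V (\<i> * complex_of_real \<omega>)) (at_right 0)" for \<omega>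
  proof (rule vec_tendstoI, rule vec_tendstoI)
    fix i j
    have "((\<lambda>\<sigma>. V $ i $ j / (Complex \<sigma> \<omega> - p)) \<longlongrightarrow> V $ i $ j / (Complex 0 \<omega> - p)) (at_right 0)"
      using p by (intro tendsto_intros) (auto simp: complex_eq_iff)
    then show "((\<lambda>\<sigma>. cauchy_kernel p V (Complex \<sigma> \<omega>) $ i $ j) \<longlongrightarrow> cauchy_kernel p V (\<i> * complex_of_real \<omega>) $ i $ j) (at_right 0)"
      by (simp add: cauchy_kernel_def Complex_eq)
  qed
  ultimately show ?thesis unfolding hardy_H2_def by (auto intro: AE_I2)
qed

lemma inner_complex_eq_Re: "x \<bullet> y = Re (x * cnj y)"
  by (simp add: inner_complex_def)

text \<open>
  Entrywise Cauchy formula at \<open>\<mu> = - cnj p\<close>: on the axis the conjugate of \<open>\<i> \<omega> - p\<close> is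
  \<open>\<mu> - \<i> \<omega>\<close>.
\<close>

lemma hardy_H2_reproduced:
  fixes F :: "complex \<Rightarrow> complex ^ 'n ^ 'm"
  assumes F: "F \<in> hardy_H2" shows "reproduced F"
proof -
  let ?S = "SUP \<sigma>\<in>{0<..}. \<integral>\<^sup>+ \<omega>. ennreal ((norm (F (Complex \<sigma> \<omega>)))\<^sup>2) \<partial>lebesgue"
  define C where "C = enn2real ?S"
  have S: "?S = ennreal C" "0 \<le> C" using F by (auto simp: hardy_H2_def C_def)
  have hol: "(\<lambda>s. F s $ i $ j) holomorphic_on {s. 0 < Re s}" for i j
    using F by (simp add: hardy_H2_def)
  have bound: "(\<integral>\<^sup>+ \<omega>. ennreal ((cmod (F (Complex \<sigma> \<omega>) $ i $ j))\<^sup>2) \<partial>lborel) \<le> ennreal C" if "0 < \<sigma>" for \<sigma> i j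
  proof -
    have "cmod (x $ i $ j) \<le> norm x" for x :: "complex ^ 'n ^ 'm"
      by (meson Finite_Cartesian_Product.norm_nth_le order_trans)
    then have "(\<integral>\<^sup>+ \<omega>. ennreal ((cmod (F (Complex \<sigma> \<omega>) $ i $ j))\<^sup>2) \<partial>lborel) \<le> (\<integral>\<^sup>+ \<omega>. ennreal ((norm (F (Complex \<sigma> \<omega>)))\<^sup>2) \<partial>lborel)"
      by (intro nn_integral_mono ennreal_leI power_mono) auto
    also have "\<dots> \<le> ?S"
      unfolding nn_integral_completion using that by (intro SUP_upper) auto
    finally show ?thesis using S by simp
  qed
  have lim: "AE \<omega> in lebesgue. ((\<lambda>\<sigma>. F (Complex \<sigma> \<omega>) $ i $ j) \<longlongrightarrow> F (\<i> * complex_of_real \<omega>) $ i $ j) (at_right 0)" for i j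
  proof -
    have "AE \<omega> in lebesgue. ((\<lambda>\<sigma>. F (Complex \<sigma> \<omega>)) \<longlongrightarrow> F (\<i> * complex_of_real \<omega>)) (at_right 0)"
      using F by (simp add: hardy_H2_def)
    then show ?thesis by eventually_elim (intro tendsto_vec_nth)
  qed
  have B: "(\<lambda>\<omega>. F (\<i> * complex_of_real \<omega>) $ i $ j) \<in> borel_measurable lebesgue"
      "integrable lebesgue (\<lambda>\<omega>. (cmod (F (\<i> * complex_of_real \<omega>) $ i $ j))\<^sup>2)"
      "\<And>\<mu>. 0 < Re \<mu> \<Longrightarrow> integrable lebesgue (\<lambda>\<omega>. F (\<i> * complex_of_real \<omega>) $ i $ j / (\<mu> - \<i> * complex_of_real \<omega>))"
      "\<And>\<mu>. 0 < Re \<mu> \<Longrightarrow>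
        (\<integral>\<omega>. F (\<i> * complex_of_real \<omega>) $ i $ j / (\<mu> - \<i> * complex_of_real \<omega>) \<partial>lebesgue) = 2 * pi * F \<mu> $ i $ j" for i j
    using cauchy_formula_boundary_values[OF hol _ S(2) lim, of i j] bound by blast+
  have L2: "axis_L2 F"
    unfolding axis_L2_def
  proof
    show "(\<lambda>\<omega>. F (\<i> * complex_of_real \<omega>)) \<in> borel_measurable lebesgue"
    proof (subst borel_measurable_euclidean_space, intro ballI)
      fix b :: "complex ^ 'n ^ 'm" assume "b \<in> Basis"
      have "(\<lambda>\<omega>. F (\<i> * complex_of_real \<omega>) \<bullet> b) = (\<lambda>\<omega>. \<Sum>i\<in>UNIV. \<Sum>j\<in>UNIV. F (\<i> * complex_of_real \<omega>) $ i $ j \<bullet> b $ i $ j)"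
        by (simp add: inner_vec_def)
      also have "\<dots> \<in> borel_measurable lebesgue"
        by (intro borel_measurable_sum borel_measurable_inner B(1) borel_measurable_const)
      finally show "(\<lambda>\<omega>. F (\<i> * complex_of_real \<omega>) \<bullet> b) \<in> borel_measurable lebesgue" .
    qed
    have "integrable lebesgue (\<lambda>\<omega>. \<Sum>i\<in>UNIV. \<Sum>j\<in>UNIV. (cmod (F (\<i> * complex_of_real \<omega>) $ i $ j))\<^sup>2)"
      by (intro Bochner_Integration.integrable_sum B(2))
    then show "integrable lebesgue (\<lambda>\<omega>. (norm (F (\<i> * complex_of_real \<omega>)))\<^sup>2)"
      by (simp add: norm_matrix_eq_Frobenius sum_nonneg)
  qed
  have "H2_inner F (cauchy_kernel p V) = F (- cnj p) \<bullet> V" if p: "Re p < 0" for p V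
  proof -
    let ?\<mu> = "- cnj p"
    have \<mu>: "0 < Re ?\<mu>" using p by simp
    have pt: "F (\<i> * complex_of_real \<omega>) \<bullet> cauchy_kernel p V (\<i> * complex_of_real \<omega>)
       = (\<Sum>i\<in>UNIV. \<Sum>j\<in>UNIV. Re (cnj (V $ i $ j) * (F (\<i> * complex_of_real \<omega>) $ i $ j / (?\<mu> - \<i> * complex_of_real \<omega>))))" for \<omega>
    proof -
      have "x \<bullet> (v / (\<i> * complex_of_real \<omega> - p)) = Re (cnj v * (x / (?\<mu> - \<i> * complex_of_real \<omega>)))" for x v
      proof -
        have "cnj (\<i> * complex_of_real \<omega> - p) = ?\<mu> - \<i> * complex_of_real \<omega>" by simp
        then have "x * cnj (v / (\<i> * complex_of_real \<omega> - p)) = cnj v * (x / (?\<mu> - \<i> * complex_of_real \<omega>))"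
          unfolding complex_cnj_divide by (simp only: times_divide_eq_right mult.commute)
        then show ?thesis by (simp only: inner_complex_eq_Re)
      qed
      then show ?thesis
        by (simp only: inner_vec_def cauchy_kernel_def vec_lambda_beta)
    qed
    have int: "integrable lebesgue (\<lambda>\<omega>. cnj (V $ i $ j) * (F (\<i> * complex_of_real \<omega>) $ i $ j / (?\<mu> - \<i> * complex_of_real \<omega>)))" for i j
      using B(3)[OF \<mu>, of i j] by (rule integrable_mult_right)
    have "(LINT \<omega>|lebesgue. F (\<i> * complex_of_real \<omega>) \<bullet> cauchy_kernel p V (\<i> * complex_of_real \<omega>))
      = (\<Sum>i\<in>UNIV. \<Sum>j\<in>UNIV. (LINT \<omega>|lebesgue. Re (cnj (V $ i $ j) * (F (\<i> * complex_of_real \<omega>) $ i $ j / (?\<mu> - \<i> * complex_of_real \<omega>)))))"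
      unfolding pt using int
      by (subst Bochner_Integration.integral_sum, intro Bochner_Integration.integrable_sum integrable_Re)
         (auto intro!: sum.cong Bochner_Integration.integral_sum integrable_Re)
    also have "\<dots> = (\<Sum>i\<in>UNIV. \<Sum>j\<in>UNIV. Re (cnj (V $ i $ j) * (2 * pi * F ?\<mu> $ i $ j)))"
      by (intro sum.cong refl)
         (simp only: integral_bounded_linear[OF bounded_linear_Re int] integral_mult_right_zero B(4)[OF \<mu>])
    also have "\<dots> = 2 * pi * (F ?\<mu> \<bullet> V)"
      unfolding inner_vec_def inner_complex_eq_Re sum_distrib_left
      by (intro sum.cong refl) (simp add: algebra_simps)
    finally show ?thesis by (simp add: H2_inner_def)
  qed
  then show ?thesis using hol L2 by (simp add: reproduced_def)
qed

lemma cauchy_kernel_reproduced: "Re p < 0 \<Longrightarrow> reproduced (cauchy_kernel p V)"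
  by (intro hardy_H2_reproduced cauchy_kernel_hardy_H2)

lemma reproduced_axis_L2: "reproduced F \<Longrightarrow> axis_L2 F" by (simp add: reproduced_def)

lemma reproduced_add:
  assumes F: "reproduced F" and G: "reproduced G" shows "reproduced (\<lambda>s. F s + G s)"
  unfolding reproduced_def
proof (intro conjI allI impI)
  show "(\<lambda>s. (F s + G s) $ i $ j) holomorphic_on {s. 0 < Re s}" for i j
    using F G by (auto simp: reproduced_def intro!: holomorphic_intros)
  show "axis_L2 (\<lambda>s. F s + G s)"
    using F G by (intro axis_L2_add reproduced_axis_L2)
  show "H2_inner (\<lambda>s. F s + G s) (cauchy_kernel p V) = (F (- cnj p) + G (- cnj p)) \<bullet> V" if p: "Re p < 0" for p V
    using F G p H2_inner_add_left[OF reproduced_axis_L2[OF F] reproduced_axis_L2[OF G]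
        reproduced_axis_L2[OF cauchy_kernel_reproduced[OF p]], of V]
    by (simp add: reproduced_def inner_add_left)
qed

lemma reproduced_scaleR:
  assumes F: "reproduced F" shows "reproduced (\<lambda>s. c *\<^sub>R F s)"
  unfolding reproduced_def
proof (intro conjI allI impI)
  show "(\<lambda>s. (c *\<^sub>R F s) $ i $ j) holomorphic_on {s. 0 < Re s}" for i j
    using F by (auto simp: reproduced_def scaleR_conv_of_real[where 'a=complex] intro!: holomorphic_intros)
qed (use F in \<open>auto simp: reproduced_def H2_inner_scaleR_left\<close>)

lemma reproduced_zero: "reproduced (\<lambda>s. 0)"
  unfolding reproduced_def by auto

lemma reproduced_sum:
  assumes "\<And>a. a \<in> A \<Longrightarrow> reproduced (F a)" shows "reproduced (\<lambda>s. \<Sum>a\<in>A. F a s)"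
  using assms by (induction A rule: infinite_finite_induct) (auto simp: reproduced_zero intro: reproduced_add)

section \<open>Integration over the parameter square\<close>

text \<open>
  A function of \<open>q = (q\<^sub>1, q\<^sub>2)\<close> that is affine in each parameter. The indices \<open>False\<close> and \<open>True\<close> stand
  for the degrees \<open>0\<close> and \<open>1\<close>. The first index belongs to \<open>q\<^sub>2\<close> because it numbers the block rows, which
  come from the output matrices; the second belongs to \<open>q\<^sub>1\<close> and numbers the block columns.
\<close>

definition pencil :: "(bool \<Rightarrow> bool \<Rightarrow> 'v::real_vector) \<Rightarrow> real \<times> real \<Rightarrow> 'v" where
  "pencil X q = (\<Sum>a\<in>UNIV. \<Sum>b\<in>UNIV. (snd q ^ of_bool a * fst q ^ of_bool b) *\<^sub>R X a b)"

text \<open>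
  The \<open>L\<^sub>2[0,1]\<close> inner products of the monomials \<open>1\<close> and \<open>q\<close>.
\<close>

definition gram :: "bool \<Rightarrow> bool \<Rightarrow> real" where
  "gram a b = 1 / (of_bool a + of_bool b + 1)"

lemma integral_power_unit_interval: "integral {0..1} (\<lambda>x::real. x ^ n) = 1 / (real n + 1)"
proof -
  have "((\<lambda>x::real. x ^ n) has_integral (1 ^ Suc n / real (Suc n) - 0 ^ Suc n / real (Suc n))) {0..1}"
  proof (rule fundamental_theorem_of_calculus)
    show "((\<lambda>x. x ^ Suc n / real (Suc n)) has_vector_derivative x ^ n) (at x within {0..1})" for x :: real
      unfolding has_real_derivative_iff_has_vector_derivative[symmetric]
      by (rule derivative_eq_intros refl | simp)+
  qed simp
  then show ?thesis by (simp add: integral_unique add.commute)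
qed

lemma param_square_cbox: "param_square = cbox (0, 0) (1, 1)"
  by (simp add: param_square_def cbox_Pair_eq)

lemma monomial_square_integral:
  "integrable (lebesgue_on param_square) (\<lambda>q. snd q ^ m * fst q ^ n)"
  "(LINT q|lebesgue_on param_square. snd q ^ m * fst q ^ n) = 1 / (real m + 1) * (1 / (real n + 1))"
proof -
  have c: "continuous_on (cbox (0, 0) (1, 1)) (\<lambda>q::real\<times>real. snd q ^ m * fst q ^ n)"
    by (intro continuous_intros)
  show i: "integrable (lebesgue_on param_square) (\<lambda>q. snd q ^ m * fst q ^ n)"
    unfolding param_square_cbox by (rule continuous_imp_integrable[OF c])
  have "(LINT q|lebesgue_on param_square. snd q ^ m * fst q ^ n) = integral (cbox (0, 0) (1, 1)) (\<lambda>q. snd q ^ m * fst q ^ n)"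
    using i unfolding param_square_cbox by (intro lebesgue_integral_eq_integral) auto
  also have "\<dots> = integral {0..1} (\<lambda>x. integral {0..1} (\<lambda>y. y ^ m * x ^ n))"
    using integral_prod_continuous[OF c] by simp
  also have "\<dots> = 1 / (real m + 1) * (1 / (real n + 1))"
    by (simp add: integral_power_unit_interval)
  finally show "(LINT q|lebesgue_on param_square. snd q ^ m * fst q ^ n) = 1 / (real m + 1) * (1 / (real n + 1))" .
qed

text \<open>
  The \<open>H\<^sub>2 \<otimes> L\<^sub>2\<close> inner product of two pencils in terms of their coefficients.
\<close>

definition tensor_inner ::
  "(bool \<Rightarrow> bool \<Rightarrow> complex \<Rightarrow> complex ^ 'n ^ 'm) \<Rightarrow> (bool \<Rightarrow> bool \<Rightarrow> complex \<Rightarrow> complex ^ 'n ^ 'm) \<Rightarrow> real" where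
  "tensor_inner X Y = (\<Sum>a\<in>UNIV. \<Sum>b\<in>UNIV. \<Sum>a'\<in>UNIV. \<Sum>b'\<in>UNIV. gram a a' * gram b b' * H2_inner (X a b) (Y a' b'))"

text \<open>
  Expanding the square for fixed \<open>q\<close> leaves monomials in \<open>q\<close> with constant coefficients, whose
  integrals are products of entries of the Gram matrix. This
  eliminates the parameters from the optimality problem.
\<close>

lemma H2L2_norm_pencil:
  assumes X: "\<And>\<omega> q. F (\<i> * complex_of_real \<omega>) q = pencil (\<lambda>a b. X a b (\<i> * complex_of_real \<omega>)) q"
    and L2: "\<And>a b. axis_L2 (X a b)"
  shows "H2L2_norm F = sqrt (tensor_inner X X)"
proof -
  have pt: "(H2_norm (\<lambda>s. F s q))\<^sup>2 = (\<Sum>a\<in>UNIV. \<Sum>b\<in>UNIV. \<Sum>a'\<in>UNIV. \<Sum>b'\<in>UNIV.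
      (snd q ^ (of_bool a + of_bool a') * fst q ^ (of_bool b + of_bool b')) * H2_inner (X a b) (X a' b'))" for q
  proof -
    let ?w = "\<lambda>a b. snd q ^ of_bool a * fst q ^ of_bool b"
    let ?P = "\<lambda>s. \<Sum>a\<in>UNIV. \<Sum>b\<in>UNIV. ?w a b *\<^sub>R X a b s"
    have L: "axis_L2 (\<lambda>s. \<Sum>b\<in>UNIV. ?w a b *\<^sub>R X a b s)" for a
      by (intro axis_L2_sum axis_L2_scaleR L2)
    have LP: "axis_L2 ?P" by (intro axis_L2_sum L)
    have left: "H2_inner ?P K = (\<Sum>a\<in>UNIV. \<Sum>b\<in>UNIV. ?w a b * H2_inner (X a b) K)" if "axis_L2 K" for K
      using that L by (simp add: H2_inner_sum_left H2_inner_scaleR_left L2 axis_L2_scaleR)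
    have "(H2_norm (\<lambda>s. F s q))\<^sup>2 = H2_inner ?P ?P"
      unfolding H2_norm_power2 by (simp add: H2_inner_def X pencil_def)
    also have "\<dots> = (\<Sum>a\<in>UNIV. \<Sum>b\<in>UNIV. ?w a b * H2_inner ?P (X a b))"
      unfolding left[OF LP] by (subst H2_inner_commute) (rule refl)
    also have "\<dots> = (\<Sum>a\<in>UNIV. \<Sum>b\<in>UNIV. \<Sum>a'\<in>UNIV. \<Sum>b'\<in>UNIV. ?w a b * (?w a' b' * H2_inner (X a' b') (X a b)))"
      by (simp only: left[OF L2] sum_distrib_left)
    also have "\<dots> = (\<Sum>a\<in>UNIV. \<Sum>b\<in>UNIV. \<Sum>a'\<in>UNIV. \<Sum>b'\<in>UNIV.
      (snd q ^ (of_bool a + of_bool a') * fst q ^ (of_bool b + of_bool b')) * H2_inner (X a b) (X a' b'))"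
      by (intro sum.cong refl) (simp only: H2_inner_commute[of "X _ _" "X _ _"] power_add mult_ac)
    finally show ?thesis .
  qed
  have "(LINT q|lebesgue_on param_square. (H2_norm (\<lambda>s. F s q))\<^sup>2) = tensor_inner X X"
    unfolding pt tensor_inner_def
    by (simp add: Bochner_Integration.integral_sum monomial_square_integral gram_def del: power_add)
  then show ?thesis by (simp add: H2L2_norm_def)
qed

lemma tensor_inner_commute: "tensor_inner X Y = tensor_inner Y X"
  unfolding tensor_inner_def UNIV_bool
  by (simp add: gram_def H2_inner_commute[of "Y _ _" "X _ _"])

lemma tensor_inner_add_left:
  assumes "\<And>a b. axis_L2 (X a b)" "\<And>a b. axis_L2 (Y a b)" "\<And>a b. axis_L2 (Z a b)"
  shows "tensor_inner (\<lambda>a b s. X a b s + Y a b s) Z = tensor_inner X Z + tensor_inner Y Z"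
  unfolding tensor_inner_def
  by (simp add: H2_inner_add_left assms distrib_left sum.distrib)

lemma tensor_inner_scaleR_left: "tensor_inner (\<lambda>a b s. c *\<^sub>R X a b s) Z = c * tensor_inner X Z"
  unfolding tensor_inner_def
  by (simp add: H2_inner_scaleR_left sum_distrib_left mult.left_commute)

lemma tensor_inner_diff:
  assumes X: "\<And>a b. axis_L2 (X a b)" and Y: "\<And>a b. axis_L2 (Y a b)"
  shows "tensor_inner (\<lambda>a b s. X a b s - Y a b s) (\<lambda>a b s. X a b s - Y a b s)
     = tensor_inner X X - 2 * tensor_inner X Y + tensor_inner Y Y"
proof -
  let ?N = "\<lambda>a b s. (-1) *\<^sub>R Y a b s"
  have N: "axis_L2 (?N a b)" for a b by (intro axis_L2_scaleR Y)
  have S: "axis_L2 (\<lambda>s. X a b s + ?N a b s)" for a b by (intro axis_L2_add X N)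
  have "tensor_inner (\<lambda>a b s. X a b s + ?N a b s) Z = tensor_inner X Z - tensor_inner Y Z"
    if "\<And>a b. axis_L2 (Z a b)" for Z
    using tensor_inner_add_left[OF X N that] tensor_inner_scaleR_left[of "-1" Y Z] by simp
  from this[OF S] this[OF X] this[OF Y] show ?thesis
    using tensor_inner_commute[of X "\<lambda>a b s. X a b s + ?N a b s"] tensor_inner_commute[of Y "\<lambda>a b s. X a b s + ?N a b s"]
      tensor_inner_commute[of X Y]
    by simp
qed

section \<open>Inner products with rank one residues\<close>

text \<open>
  The matrix \<open>c b\<^sup>*\<close>.
\<close>

definition rank_one :: "complex ^ 'm \<Rightarrow> complex ^ 'n \<Rightarrow> complex ^ 'n ^ 'm" where
  "rank_one c b = (\<chi> i j. c $ i * cnj (b $ j))"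

lemma rank_one_linear:
  "rank_one (c + c') b = rank_one c b + rank_one c' b" "rank_one c (b + b') = rank_one c b + rank_one c b'"
  "rank_one (t *\<^sub>R c) b = t *\<^sub>R rank_one c b" "rank_one c (t *\<^sub>R b) = t *\<^sub>R rank_one c b"
  by (simp_all add: rank_one_def vec_eq_iff algebra_simps scaleR_conv_of_real[where 'a=complex])

lemma inner_rank_one: "F \<bullet> rank_one c b = Re (row_times_col (conj_vec c) (F *v b))"
  by (simp add: inner_vec_def rank_one_def inner_complex_eq_Re row_times_col_def conj_vec_def
      matrix_vector_mult_def sum_distrib_left algebra_simps)

definition gram_stack :: "(bool \<Rightarrow> complex ^ 'n) \<Rightarrow> complex ^ ('n + 'n)" where
  "gram_stack v = block_matrix (mat 1) (mat (1/2)) (mat (1/2)) (mat (1/3)) *v stack_vec (v False) (v True)"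

lemma sum_UNIV_Plus: "(\<Sum>i\<in>UNIV. f i) = (\<Sum>k\<in>UNIV. f (Inl k)) + (\<Sum>k\<in>UNIV. f (Inr k))"
  for f :: "'a::finite + 'b::finite \<Rightarrow> complex"
  unfolding UNIV_Plus_UNIV[symmetric] by (subst sum.Plus) (auto simp: o_def)

lemma block_matrix_mult_stack_vec:
  "block_matrix A11 A12 A21 A22 *v stack_vec x y = stack_vec (A11 *v x + A12 *v y) (A21 *v x + A22 *v y)"
  by (auto simp: vec_eq_iff matrix_vector_mult_def block_matrix_def stack_vec_def sum_UNIV_Plus split: sum.split)

lemma mat_mult_vec: "mat (k::complex) *v x = (\<chi> i. k * x $ i)"
  by (auto simp: vec_eq_iff matrix_vector_mult_def mat_def if_distrib[of "\<lambda>z. z * _"] cong: if_cong)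

lemma gram_stack_eq: "gram_stack v = stack_vec (\<Sum>a\<in>UNIV. gram False a *\<^sub>R v a) (\<Sum>a\<in>UNIV. gram True a *\<^sub>R v a)"
  unfolding gram_stack_def block_matrix_mult_stack_vec
  by (auto simp: vec_eq_iff stack_vec_def mat_mult_vec UNIV_bool gram_def scaleR_conv_of_real[where 'a=complex] split: sum.split)

lemma row_times_col_stack_vec:
  "row_times_col (conj_vec (stack_vec x y)) (stack_vec u v) = row_times_col (conj_vec x) u + row_times_col (conj_vec y) v"
  by (simp add: row_times_col_def sum_UNIV_Plus conj_vec_def stack_vec_def)

definition block_family :: "(bool \<Rightarrow> bool \<Rightarrow> complex ^ 'n ^ 'm) \<Rightarrow> complex ^ ('n + 'n) ^ ('m + 'm)" where
  "block_family X = block_matrix (X False False) (X False True) (X True False) (X True True)"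

text \<open>
  The Gram matrices act on the residue vectors alone, and the sum over blocks is a product of block
  matrices.
\<close>

lemma gram_form_eq:
  "(\<Sum>a\<in>UNIV. \<Sum>b\<in>UNIV. \<Sum>a'\<in>UNIV. \<Sum>b'\<in>UNIV. gram a a' * gram b b' * (X a b \<bullet> rank_one (\<gamma> a') (\<beta> b')))
   = Re (row_times_col (conj_vec (gram_stack \<gamma>)) (block_family X *v gram_stack \<beta>))"
proof -
  have "(\<Sum>a\<in>UNIV. \<Sum>b\<in>UNIV. \<Sum>a'\<in>UNIV. \<Sum>b'\<in>UNIV. gram a a' * gram b b' * (X a b \<bullet> rank_one (\<gamma> a') (\<beta> b')))
    = (\<Sum>a\<in>UNIV. \<Sum>b\<in>UNIV. X a b \<bullet> rank_one (\<Sum>a'\<in>UNIV. gram a a' *\<^sub>R \<gamma> a') (\<Sum>b'\<in>UNIV. gram b b' *\<^sub>R \<beta> b'))"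
    unfolding UNIV_bool by (simp add: rank_one_linear inner_add_right algebra_simps)
  also have "\<dots> = Re (row_times_col (conj_vec (gram_stack \<gamma>)) (block_family X *v gram_stack \<beta>))"
    unfolding gram_stack_eq block_family_def block_matrix_mult_stack_vec row_times_col_stack_vec inner_rank_one
    by (simp add: UNIV_bool row_times_col_def distrib_left sum.distrib)
  finally show ?thesis .
qed

lemma tensor_inner_cauchy_kernel:
  assumes X: "\<And>a b. reproduced (X a b)" and p: "Re p < 0"
  shows "tensor_inner X (\<lambda>a b. cauchy_kernel p (rank_one (\<gamma> a) (\<beta> b)))
    = Re (row_times_col (conj_vec (gram_stack \<gamma>)) (block_family (\<lambda>a b. X a b (- cnj p)) *v gram_stack \<beta>))"
  using X p unfolding tensor_inner_def gram_form_eq[symmetric] reproduced_def by simp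

text \<open>
  The inverse of the Gram matrix is \<open>(4, -6; -6, 12)\<close>.
\<close>

lemma gram_stack_surj: "\<exists>v. gram_stack v = w"
proof
  let ?x = "\<chi> i. w $ Inl i" and ?y = "\<chi> i. w $ Inr i"
  show "gram_stack (\<lambda>a. if a then 12 *\<^sub>R ?y - 6 *\<^sub>R ?x else 4 *\<^sub>R ?x - 6 *\<^sub>R ?y) = w"
    unfolding gram_stack_eq
    by (auto simp: vec_eq_iff stack_vec_def UNIV_bool gram_def algebra_simps scaleR_conv_of_real[where 'a=complex] split: sum.split)
qed

section \<open>Models in pole-residue form\<close>

text \<open>
  The coefficients of the transfer function of a model as a pencil. Unlike the resolvent, the
  pole-residue form is a sum of Cauchy kernels also at the poles.
\<close>

definition model :: "complex ^ 'r \<Rightarrow> (bool \<Rightarrow> complex ^ 'ni ^ 'r) \<Rightarrow> (bool \<Rightarrow> complex ^ 'r ^ 'no)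
    \<Rightarrow> bool \<Rightarrow> bool \<Rightarrow> complex \<Rightarrow> complex ^ 'ni ^ 'no" where
  "model d B C a b s = (\<chi> i j. \<Sum>k\<in>UNIV. C a $ i $ k * B b $ k $ j / (s - d $ k))"

text \<open>
  The vector \<open>B\<^sup>* e\<close> for the \<open>k\<close>-th unit vector \<open>e\<close>, so that \<open>rank_one\<close> recovers the \<open>k\<close>-th row of \<open>B\<close>.
\<close>

definition conj_row :: "'r \<Rightarrow> complex ^ 'ni ^ 'r \<Rightarrow> complex ^ 'ni" where
  "conj_row k B = (\<chi> j. cnj (B $ k $ j))"

lemma model_sum_cauchy_kernel:
  "model d B C a b = (\<lambda>s. \<Sum>k\<in>UNIV. cauchy_kernel (d $ k) (rank_one (column k (C a)) (conj_row k (B b))) s)"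
  by (simp add: fun_eq_iff vec_eq_iff model_def cauchy_kernel_def rank_one_def column_def conj_row_def sum_component)

lemma model_reproduced:
  assumes "\<And>k. Re (d $ k) < 0" shows "reproduced (model d B C a b)"
  unfolding model_sum_cauchy_kernel by (intro reproduced_sum cauchy_kernel_reproduced assms)

lemma matrix_inv_resolvent_diag:
  fixes d :: "complex ^ 'r"
  assumes "\<And>k. s \<noteq> d $ k"
  shows "matrix_inv (mat s - diag_matrix d) = diag_matrix (\<chi> k. 1 / (s - d $ k))"
proof -
  have prod: "diag_matrix x ** diag_matrix y = diag_matrix (\<chi> k. x $ k * y $ k)" for x y :: "complex ^ 'r"
    by (auto simp: vec_eq_iff matrix_matrix_mult_def diag_matrix_def if_distrib[of "\<lambda>z. z * _"] cong: if_cong)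
  have eq: "mat s - diag_matrix d = diag_matrix (\<chi> k. s - d $ k)"
    by (auto simp: vec_eq_iff mat_def diag_matrix_def)
  have one: "diag_matrix (\<chi> k. 1) = (mat 1 :: complex ^ 'r ^ 'r)"
    by (auto simp: vec_eq_iff mat_def diag_matrix_def)
  let ?A = "diag_matrix (\<chi> k. s - d $ k)" and ?X = "diag_matrix (\<chi> k. 1 / (s - d $ k))"
  have 1: "?A ** ?X = mat 1" "?X ** ?A = mat 1"
    using assms by (simp_all add: prod flip: one)
  have "?A ** matrix_inv ?A = mat 1 \<and> matrix_inv ?A ** ?A = mat 1"
    unfolding matrix_inv_def by (rule someI[where x = ?X]) (use 1 in auto)
  then have "matrix_inv ?A = ?X"
    by (metis 1(2) matrix_mul_assoc matrix_mul_lid matrix_mul_rid)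
  then show ?thesis by (simp add: eq)
qed

lemma matrix_mult_diag_mult:
  "(C ** diag_matrix e ** B) $ i $ j = (\<Sum>k\<in>UNIV. C $ i $ k * e $ k * B $ k $ j)"
  by (auto simp: matrix_matrix_mult_def diag_matrix_def if_distrib[of "\<lambda>z. _ * z"] cong: if_cong)

lemma rom_transfer_eq_pencil:
  assumes "\<And>k. s \<noteq> d $ k"
  shows "rom_transfer (diag_matrix d, B False, B True, C False, C True) s q = pencil (\<lambda>a b. model d B C a b s) q"
  by (cases q) (simp add: vec_eq_iff matrix_inv_resolvent_diag[OF assms] matrix_mult_diag_mult pencil_def UNIV_bool
      model_def scaleR_conv_of_real[where 'a=complex] algebra_simps sum.distrib sum_distrib_left add_divide_distrib)

lemma stacked_transfer_eq_block_family:
  assumes "\<And>k. s \<noteq> d $ k"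
  shows "stack_rows (C False) (C True) ** matrix_inv (mat s - diag_matrix d) ** append_cols (B False) (B True)
    = block_family (\<lambda>a b. model d B C a b s)"
  by (auto simp: vec_eq_iff matrix_inv_resolvent_diag[OF assms] matrix_mult_diag_mult block_family_def block_matrix_def
      stack_rows_def append_cols_def model_def split: sum.split)

lemma model_perturb_B:
  "model d (\<lambda>b. B b + t *\<^sub>R rank_one (axis l 1) (\<beta> b)) C a b s
   = model d B C a b s + t *\<^sub>R cauchy_kernel (d $ l) (rank_one (column l (C a)) (\<beta> b)) s"
proof -
  have "(\<Sum>k\<in>UNIV. C a $ i $ k * (B b $ k $ j + of_real t * (axis l 1 $ k * cnj (\<beta> b $ j))) / (s - d $ k))
    = (\<Sum>k\<in>UNIV. C a $ i $ k * B b $ k $ j / (s - d $ k)) + of_real t * (C a $ i $ l * cnj (\<beta> b $ j) / (s - d $ l))" for i j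
  proof -
    have "(\<Sum>k\<in>UNIV. C a $ i $ k * (B b $ k $ j + of_real t * (axis l 1 $ k * cnj (\<beta> b $ j))) / (s - d $ k))
     = (\<Sum>k\<in>UNIV. C a $ i $ k * B b $ k $ j / (s - d $ k) + (if k = l then of_real t * (C a $ i $ l * cnj (\<beta> b $ j) / (s - d $ l)) else 0))"
      by (intro sum.cong refl) (auto simp: axis_def add_divide_distrib distrib_left)
    then show ?thesis by (simp add: sum.distrib)
  qed
  then show ?thesis
    by (simp add: vec_eq_iff model_def cauchy_kernel_def rank_one_def column_def scaleR_conv_of_real[where 'a=complex])
qed

lemma model_perturb_C:
  "model d B (\<lambda>a. C a + t *\<^sub>R rank_one (\<gamma> a) (axis l 1)) a b s
   = model d B C a b s + t *\<^sub>R cauchy_kernel (d $ l) (rank_one (\<gamma> a) (conj_row l (B b))) s"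
proof -
  have "(\<Sum>k\<in>UNIV. (C a $ i $ k + of_real t * (\<gamma> a $ i * cnj (axis l 1 $ k))) * B b $ k $ j / (s - d $ k))
    = (\<Sum>k\<in>UNIV. C a $ i $ k * B b $ k $ j / (s - d $ k)) + of_real t * (\<gamma> a $ i * B b $ l $ j / (s - d $ l))" for i j
  proof -
    have "(\<Sum>k\<in>UNIV. (C a $ i $ k + of_real t * (\<gamma> a $ i * cnj (axis l 1 $ k))) * B b $ k $ j / (s - d $ k))
     = (\<Sum>k\<in>UNIV. C a $ i $ k * B b $ k $ j / (s - d $ k) + (if k = l then of_real t * (\<gamma> a $ i * B b $ l $ j / (s - d $ l)) else 0))"
      by (intro sum.cong refl) (auto simp: axis_def add_divide_distrib distrib_right)
    then show ?thesis by (simp add: sum.distrib)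
  qed
  then show ?thesis
    by (simp add: vec_eq_iff model_def cauchy_kernel_def rank_one_def conj_row_def scaleR_conv_of_real[where 'a=complex])
qed

lemma model_perturb_pole:
  "model (d + axis l t) B C a b s = model d B C a b s
     + (cauchy_kernel (d $ l + t) (rank_one (column l (C a)) (conj_row l (B b))) s
        - cauchy_kernel (d $ l) (rank_one (column l (C a)) (conj_row l (B b))) s)"
proof -
  have "(\<Sum>k\<in>UNIV. C a $ i $ k * B b $ k $ j / (s - (d $ k + axis l t $ k)))
    = (\<Sum>k\<in>UNIV. C a $ i $ k * B b $ k $ j / (s - d $ k))
      + (C a $ i $ l * B b $ l $ j / (s - (d $ l + t)) - C a $ i $ l * B b $ l $ j / (s - d $ l))" for i j
  proof -
    have "(\<Sum>k\<in>UNIV. C a $ i $ k * B b $ k $ j / (s - (d $ k + axis l t $ k)))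
     = (\<Sum>k\<in>UNIV. C a $ i $ k * B b $ k $ j / (s - d $ k)
        + (if k = l then C a $ i $ l * B b $ l $ j / (s - (d $ l + t)) - C a $ i $ l * B b $ l $ j / (s - d $ l) else 0))"
      by (intro sum.cong refl) (auto simp: axis_def)
    then show ?thesis by (simp add: sum.distrib)
  qed
  then show ?thesis
    by (simp add: vec_eq_iff model_def cauchy_kernel_def rank_one_def column_def conj_row_def)
qed

text \<open>
  The increment is the kernel at \<open>p\<close> times \<open>t / (s - p - t)\<close>, and \<open>\<bar>s - p - t\<bar> \<ge> - Re p / 2\<close>
  on the axis as long as \<open>\<bar>t\<bar> \<le> - Re p / 2\<close>.
\<close>

lemma H2_inner_cauchy_kernel_increment_le:
  fixes V W :: "complex ^ 'n ^ 'm"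
  assumes p: "Re p < 0"
  shows "\<exists>K. \<forall>t. cmod t \<le> - Re p / 2 \<longrightarrow>
     H2_inner (\<lambda>s. cauchy_kernel (p + t) V s - cauchy_kernel p V s) (\<lambda>s. cauchy_kernel (p + t) W s - cauchy_kernel p W s)
       \<le> K * (cmod t)\<^sup>2"
proof -
  have L2: "axis_L2 (cauchy_kernel z V)" if "Re z < 0" for z and V :: "complex ^ 'n ^ 'm"
    using that by (intro reproduced_axis_L2 cauchy_kernel_reproduced)
  have L2d: "axis_L2 (\<lambda>s. cauchy_kernel (p + t) V s - cauchy_kernel p V s)" if "Re (p + t) < 0" for t and V :: "complex ^ 'n ^ 'm"
    using axis_L2_add[OF L2[OF that, of V] axis_L2_scaleR[OF L2[OF p, of V], of "-1"]] by simp
  let ?s = "\<lambda>\<omega>. \<i> * complex_of_real \<omega>"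
  have incr: "norm (cauchy_kernel (p + t) V (?s \<omega>) - cauchy_kernel p V (?s \<omega>)) \<le> 2 * cmod t / (- Re p) * norm (cauchy_kernel p V (?s \<omega>))"
    if t: "cmod t \<le> - Re p / 2" for t \<omega> and V :: "complex ^ 'n ^ 'm"
  proof -
    have re: "- Re p / 2 \<le> \<bar>Re (?s \<omega> - (p + t))\<bar>"
      using t abs_Re_le_cmod[of t] by auto
    also have "\<dots> \<le> cmod (?s \<omega> - (p + t))" by (rule abs_Re_le_cmod)
    finally have c: "- Re p / 2 \<le> cmod (?s \<omega> - (p + t))" .
    have ne1: "?s \<omega> - p \<noteq> 0" using p by (auto simp: complex_eq_iff)
    have ne2: "?s \<omega> - (p + t) \<noteq> 0"
    proof
      assume h: "?s \<omega> - (p + t) = 0"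
      show False using c p unfolding h by simp
    qed
    have "v / (?s \<omega> - (p + t)) - v / (?s \<omega> - p) = t / (?s \<omega> - (p + t)) * (v / (?s \<omega> - p))" for v
      using ne1 ne2 by (simp add: field_simps)
    then have "cauchy_kernel (p + t) V (?s \<omega>) - cauchy_kernel p V (?s \<omega>)
      = (\<chi> i j. t / (?s \<omega> - (p + t)) * cauchy_kernel p V (?s \<omega>) $ i $ j)"
      by (simp add: vec_eq_iff cauchy_kernel_def)
    then have "norm (cauchy_kernel (p + t) V (?s \<omega>) - cauchy_kernel p V (?s \<omega>))
      = cmod t / cmod (?s \<omega> - (p + t)) * norm (cauchy_kernel p V (?s \<omega>))"
      by (simp only: norm_matrix_scale norm_divide)
    also have "\<dots> \<le> cmod t / (- Re p / 2) * norm (cauchy_kernel p V (?s \<omega>))"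
      using p c by (intro mult_right_mono divide_left_mono mult_pos_pos) auto
    finally show ?thesis by (simp add: field_simps)
  qed
  define K where "K = 4 / (Re p)\<^sup>2 * (H2_inner (cauchy_kernel p V) (cauchy_kernel p V) + H2_inner (cauchy_kernel p W) (cauchy_kernel p W))"
  have "H2_inner (\<lambda>s. cauchy_kernel (p + t) V s - cauchy_kernel p V s) (\<lambda>s. cauchy_kernel (p + t) W s - cauchy_kernel p W s)
       \<le> K * (cmod t)\<^sup>2" if t: "cmod t \<le> - Re p / 2" for t
  proof -
    define c where "c = 2 * cmod t / (- Re p)"
    have c0: "0 \<le> c" using p by (simp add: c_def divide_nonneg_neg)
    have neg: "Re (p + t) < 0" using t p abs_Re_le_cmod[of t] by auto
    have incr': "norm (cauchy_kernel (p + t) U (?s \<omega>) - cauchy_kernel p U (?s \<omega>)) \<le> c * norm (cauchy_kernel p U (?s \<omega>))"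
      for \<omega> and U :: "complex ^ 'n ^ 'm"
      unfolding c_def by (rule incr[OF t])
    let ?v = "\<lambda>\<omega>. cauchy_kernel p V (?s \<omega>)" and ?w = "\<lambda>\<omega>. cauchy_kernel p W (?s \<omega>)"
    have "(LINT \<omega>|lebesgue. (cauchy_kernel (p + t) V (?s \<omega>) - ?v \<omega>) \<bullet> (cauchy_kernel (p + t) W (?s \<omega>) - ?w \<omega>))
      \<le> (LINT \<omega>|lebesgue. c\<^sup>2 * (?v \<omega> \<bullet> ?v \<omega> + ?w \<omega> \<bullet> ?w \<omega>))"
    proof (rule integral_mono)
      show "integrable lebesgue (\<lambda>\<omega>. (cauchy_kernel (p + t) V (?s \<omega>) - ?v \<omega>) \<bullet> (cauchy_kernel (p + t) W (?s \<omega>) - ?w \<omega>))"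
        by (rule axis_L2_inner_integrable[OF L2d[OF neg] L2d[OF neg]])
      show "integrable lebesgue (\<lambda>\<omega>. c\<^sup>2 * (?v \<omega> \<bullet> ?v \<omega> + ?w \<omega> \<bullet> ?w \<omega>))"
        by (intro integrable_mult_right Bochner_Integration.integrable_add axis_L2_inner_integrable L2 p)
      fix \<omega>
      have "(cauchy_kernel (p + t) V (?s \<omega>) - ?v \<omega>) \<bullet> (cauchy_kernel (p + t) W (?s \<omega>) - ?w \<omega>)
        \<le> norm (cauchy_kernel (p + t) V (?s \<omega>) - ?v \<omega>) * norm (cauchy_kernel (p + t) W (?s \<omega>) - ?w \<omega>)"
        by (rule norm_cauchy_schwarz)
      also have "\<dots> \<le> (c * norm (?v \<omega>)) * (c * norm (?w \<omega>))"
        by (intro mult_mono incr' mult_nonneg_nonneg c0 norm_ge_zero)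
      also have "\<dots> = c\<^sup>2 * (norm (?v \<omega>) * norm (?w \<omega>))" by (simp add: power2_eq_square)
      also have "\<dots> \<le> c\<^sup>2 * ((norm (?v \<omega>))\<^sup>2 + (norm (?w \<omega>))\<^sup>2)"
      proof (intro mult_left_mono)
        have "0 \<le> (norm (?v \<omega>))\<^sup>2 + (norm (?w \<omega>))\<^sup>2 - 2 * norm (?v \<omega>) * norm (?w \<omega>)"
          unfolding power2_diff[symmetric] by simp
        moreover have "0 \<le> norm (?v \<omega>) * norm (?w \<omega>)" by simp
        ultimately show "norm (?v \<omega>) * norm (?w \<omega>) \<le> (norm (?v \<omega>))\<^sup>2 + (norm (?w \<omega>))\<^sup>2" by linarith
      qed simp
      finally show "(cauchy_kernel (p + t) V (?s \<omega>) - ?v \<omega>) \<bullet> (cauchy_kernel (p + t) W (?s \<omega>) - ?w \<omega>)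
        \<le> c\<^sup>2 * (?v \<omega> \<bullet> ?v \<omega> + ?w \<omega> \<bullet> ?w \<omega>)" by (simp add: power2_norm_eq_inner)
    qed
    also have "\<dots> = c\<^sup>2 * ((LINT \<omega>|lebesgue. ?v \<omega> \<bullet> ?v \<omega>) + (LINT \<omega>|lebesgue. ?w \<omega> \<bullet> ?w \<omega>))"
      by (simp add: Bochner_Integration.integral_add axis_L2_inner_integrable L2 p)
    finally have le: "(LINT \<omega>|lebesgue. (cauchy_kernel (p + t) V (?s \<omega>) - ?v \<omega>) \<bullet> (cauchy_kernel (p + t) W (?s \<omega>) - ?w \<omega>))
      \<le> c\<^sup>2 * ((LINT \<omega>|lebesgue. ?v \<omega> \<bullet> ?v \<omega>) + (LINT \<omega>|lebesgue. ?w \<omega> \<bullet> ?w \<omega>))" .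
    have "H2_inner (\<lambda>s. cauchy_kernel (p + t) V s - cauchy_kernel p V s) (\<lambda>s. cauchy_kernel (p + t) W s - cauchy_kernel p W s)
       \<le> c\<^sup>2 * (H2_inner (cauchy_kernel p V) (cauchy_kernel p V) + H2_inner (cauchy_kernel p W) (cauchy_kernel p W))"
      unfolding H2_inner_def using mult_left_mono[OF le, of "1 / (2 * pi)"] by (simp add: algebra_simps add_divide_distrib)
    also have "\<dots> = K * (cmod t)\<^sup>2" by (simp add: K_def c_def power2_eq_square)
    finally show ?thesis .
  qed
  then show ?thesis by blast
qed

section \<open>First-order optimality\<close>

lemma quadratic_dominates_imp_zero:
  fixes x y \<delta> :: real
  assumes \<delta>: "0 < \<delta>" and le: "\<And>t. \<bar>t\<bar> < \<delta> \<Longrightarrow> 2 * (t * x) \<le> t\<^sup>2 * y"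
  shows "x = 0"
proof (rule ccontr)
  assume x: "x \<noteq> 0"
  define m where "m = min (\<delta>/2) (\<bar>x\<bar> / (\<bar>y\<bar> + 1))"
  have m: "0 < m" "m < \<delta>"
    using \<delta> x by (auto simp: m_def min_less_iff_disj add_nonneg_pos)
  have "m \<le> \<bar>x\<bar> / (\<bar>y\<bar> + 1)" by (simp add: m_def)
  then have m3: "m * (\<bar>y\<bar> + 1) \<le> \<bar>x\<bar>" by (simp add: pos_le_divide_eq add_nonneg_pos)
  have "2 * ((sgn x * m) * x) \<le> (sgn x * m)\<^sup>2 * y"
    using m x by (intro le) (auto simp: abs_mult)
  then have "2 * m * \<bar>x\<bar> \<le> m * m * y"
    using x by (simp add: power_mult_distrib power2_eq_square sgn_if split: if_splits)
  then have "m * (2 * \<bar>x\<bar>) \<le> m * (m * y)" by (simp add: algebra_simps)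
  then have "2 * \<bar>x\<bar> \<le> m * y" using m(1) by simp
  also have "\<dots> \<le> m * (\<bar>y\<bar> + 1)" using m(1) by (intro mult_left_mono) auto
  finally show False using m3 x by simp
qed

text \<open>
  In the direction \<open>w = cnj e'\<close> the real part of \<open>e\<close> grows at the rate \<open>\<bar>e'\<bar>\<^sup>2\<close>, and subtracting the
  quadratic term does not change the derivative at \<open>0\<close>.
\<close>

lemma deriv_zero_of_quadratic_bound:
  fixes e :: "complex \<Rightarrow> complex"
  assumes der: "(e has_field_derivative e') (at \<mu>)" and \<delta>: "0 < \<delta>"
    and le: "\<And>\<tau>. cmod \<tau> < \<delta> \<Longrightarrow> Re (e (\<mu> + \<tau>) - e \<mu>) \<le> K * (cmod \<tau>)\<^sup>2"
  shows "e' = 0"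
proof (rule ccontr)
  assume ne: "e' \<noteq> 0"
  define w where "w = cnj e'"
  define g where "g h = Re (e (\<mu> + of_real h * w)) - K * (cmod w)\<^sup>2 * h\<^sup>2" for h :: real
  have "((\<lambda>h. e (\<mu> + of_real h * w)) has_vector_derivative e' * w) (at 0)"
  proof -
    have "((\<lambda>z. e (\<mu> + z * w)) has_field_derivative e' * w) (at (of_real 0))"
      by (rule DERIV_chain'[where g=e and f="\<lambda>z. \<mu> + z * w", THEN DERIV_cong]) (auto intro!: derivative_eq_intros der)
    then show ?thesis by (rule has_vector_derivative_real_field)
  qed
  then have h: "((\<lambda>h. Re (e (\<mu> + of_real h * w))) has_real_derivative Re (e' * w)) (at 0)"
    unfolding has_real_derivative_iff_has_vector_derivative
    by (rule bounded_linear.has_vector_derivative[OF bounded_linear_Re])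
  have "(g has_real_derivative Re (e' * w)) (at 0)"
    unfolding g_def by (rule h derivative_eq_intros refl | simp)+
  moreover have "0 < Re (e' * w)"
  proof -
    have "e' * w = of_real ((cmod e')\<^sup>2)" unfolding w_def by (rule complex_norm_square[symmetric])
    then show ?thesis using ne by (simp only: Re_complex_of_real) simp
  qed
  ultimately obtain d where d: "0 < d" "\<And>h. 0 < h \<Longrightarrow> h < d \<Longrightarrow> g 0 < g (0 + h)"
    using DERIV_pos_inc_right by blast
  have w: "0 < cmod w" using ne by (simp add: w_def)
  define h where "h = min (d / 2) (\<delta> / (2 * cmod w))"
  have h: "0 < h" "h < d" "h * cmod w < \<delta>"
    using d(1) \<delta> w by (auto simp: h_def min_def field_simps)
  have "Re (e (\<mu> + of_real h * w) - e \<mu>) \<le> K * (cmod (of_real h * w))\<^sup>2"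
    using h by (intro le) (simp add: norm_mult)
  then have "g h \<le> g 0" by (simp add: g_def norm_mult power_mult_distrib algebra_simps)
  then show False using d(2)[OF h(1,2)] by simp
qed

text \<open>
  Expand \<open>\<parallel>E\<parallel>\<^sup>2 \<le> \<parallel>E - D t\<parallel>\<^sup>2\<close>. The family \<open>\<rho>\<close> of models may depend nonlinearly on \<open>t\<close>; continuity keeps it
  within the neighbourhood in which \<open>R\<close> is minimal.
\<close>

lemma optimality_variation:
  fixes R :: "('r::finite, 'ni::finite, 'no::finite) rom" and \<rho> :: "'t::real_normed_vector \<Rightarrow> ('r, 'ni, 'no) rom"
  assumes opt: "H2L2_optimal H R"
    and E: "\<And>\<omega> q. H (\<i> * complex_of_real \<omega>) q - rom_transfer R (\<i> * complex_of_real \<omega>) q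
        = pencil (\<lambda>a b. E a b (\<i> * complex_of_real \<omega>)) q"
    and EL: "\<And>a b. axis_L2 (E a b)"
    and \<rho>0: "\<rho> 0 = R" and cont: "isCont \<rho> 0"
    and \<delta>: "0 < \<delta>" and adm: "\<And>t. norm t < \<delta> \<Longrightarrow> \<rho> t \<in> admissible_roms"
    and D: "\<And>t \<omega> q. norm t < \<delta> \<Longrightarrow> rom_transfer (\<rho> t) (\<i> * complex_of_real \<omega>) q
        = rom_transfer R (\<i> * complex_of_real \<omega>) q + pencil (\<lambda>a b. D t a b (\<i> * complex_of_real \<omega>)) q"
    and DL: "\<And>t a b. norm t < \<delta> \<Longrightarrow> axis_L2 (D t a b)"
  shows "\<exists>\<eta>>0. \<forall>t. norm t < \<eta> \<longrightarrow> 2 * tensor_inner E (D t) \<le> tensor_inner (D t) (D t)"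
proof -
  obtain \<epsilon> where \<epsilon>: "0 < \<epsilon>" and min: "\<And>R'. R' \<in> admissible_roms \<Longrightarrow> dist R' R < \<epsilon> \<Longrightarrow>
        H2L2_norm (\<lambda>s q. H s q - rom_transfer R s q) \<le> H2L2_norm (\<lambda>s q. H s q - rom_transfer R' s q)"
    using opt unfolding H2L2_optimal_def by blast
  obtain \<eta> where \<eta>: "0 < \<eta>" and close: "\<And>t. dist t 0 < \<eta> \<Longrightarrow> dist (\<rho> t) R < \<epsilon>"
    using cont \<epsilon> unfolding continuous_at_eps_delta \<rho>0 by blast
  have "2 * tensor_inner E (D t) \<le> tensor_inner (D t) (D t)" if t: "norm t < min \<eta> \<delta>" for t
  proof -
    have t1: "norm t < \<delta>" and t2: "dist t 0 < \<eta>" using t by auto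
    have "H2L2_norm (\<lambda>s q. H s q - rom_transfer R s q) \<le> H2L2_norm (\<lambda>s q. H s q - rom_transfer (\<rho> t) s q)"
      by (rule min[OF adm[OF t1] close[OF t2]])
    also have "H2L2_norm (\<lambda>s q. H s q - rom_transfer R s q) = sqrt (tensor_inner E E)"
      by (rule H2L2_norm_pencil[OF E EL])
    also have "H2L2_norm (\<lambda>s q. H s q - rom_transfer (\<rho> t) s q)
        = sqrt (tensor_inner (\<lambda>a b s. E a b s - D t a b s) (\<lambda>a b s. E a b s - D t a b s))"
    proof (rule H2L2_norm_pencil)
      show "H (\<i> * complex_of_real \<omega>) q - rom_transfer (\<rho> t) (\<i> * complex_of_real \<omega>) q
          = pencil (\<lambda>a b. E a b (\<i> * complex_of_real \<omega>) - D t a b (\<i> * complex_of_real \<omega>)) q" for \<omega> q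
        using E[of \<omega> q] D[OF t1, of \<omega> q]
        by (simp add: pencil_def scaleR_diff_right sum_subtractf algebra_simps)
      show "axis_L2 (\<lambda>s. E a b s - D t a b s)" for a b
        using axis_L2_add[OF EL axis_L2_scaleR[OF DL[OF t1], of "-1"]] by simp
    qed
    finally show ?thesis
      using tensor_inner_diff[OF EL DL[OF t1]] by simp
  qed
  then show ?thesis using \<eta> \<delta> by (intro exI[of _ "min \<eta> \<delta>"]) auto
qed

lemma row_times_col_vector_matrix: "row_times_col x (F *v b) = row_times_col (x v* F) b"
  unfolding row_times_col_def matrix_vector_mult_def vector_matrix_mult_def
  by (simp add: sum_distrib_left sum_distrib_right, subst sum.swap) (simp add: mult_ac)

lemma Re_row_times_col_eq_0: 
  assumes "\<And>v. Re (row_times_col r v) = 0" shows "r = 0"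
proof -
  have "r $ i = 0" for i
  proof (rule complex_eqI)
    have *: "row_times_col r (axis i z) = r $ i * z" for z
      by (simp add: row_times_col_def axis_def if_distrib[of "\<lambda>z. _ * z"] cong: if_cong)
    show "Re (r $ i) = Re 0" using assms[of "axis i 1"] by (simp add: *)
    show "Im (r $ i) = Im 0" using assms[of "axis i \<i>"] by (simp add: *)
  qed
  then show ?thesis by (simp add: vec_eq_iff)
qed

lemma row_times_col_commute: "row_times_col x y = row_times_col y x"
  by (simp add: row_times_col_def mult.commute)

lemma conj_vec_conj_vec [simp]: "conj_vec (conj_vec x) = x"
  by (simp add: conj_vec_def vec_eq_iff)

lemma matrix_vector_mult_axis: "A *v axis l 1 = column l A" for A :: "complex ^ 'n ^ 'm"
  by (simp add: vec_eq_iff matrix_vector_mult_def axis_def column_def if_distrib[of "\<lambda>z. _ * z"] cong: if_cong)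

lemma block_family_holomorphic:
  assumes "\<And>a b. reproduced (X a b)"
  shows "(\<lambda>s. block_family (\<lambda>a b. X a b s) $ i $ j) holomorphic_on {s. 0 < Re s}"
  using assms by (cases i; cases j) (auto simp: block_family_def block_matrix_def reproduced_def)

definition model_error where
  "model_error F d B C a b s = F a b s - model d B C a b s"

text \<open>
  The coefficients \<open>F\<close> of the full model and the matrices of the reduced model are indexed as in
  \<open>pencil\<close>, so that \<open>B True\<close> is the coefficient of \<open>q\<^sub>1\<close> and \<open>C True\<close> that of \<open>q\<^sub>2\<close>.
\<close>

locale optimal_model =
  fixes H :: "complex \<Rightarrow> real \<times> real \<Rightarrow> complex ^ 'ni ^ 'no" and d :: "complex ^ 'r"
    and B :: "bool \<Rightarrow> complex ^ 'ni ^ 'r" and C :: "bool \<Rightarrow> complex ^ 'r ^ 'no"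
    and F :: "bool \<Rightarrow> bool \<Rightarrow> complex \<Rightarrow> complex ^ 'ni ^ 'no"
  assumes stable: "\<And>k. Re (d $ k) < 0"
    and opt: "H2L2_optimal H (diag_matrix d, B False, B True, C False, C True)"
    and H: "\<And>s q. H s q = pencil (\<lambda>a b. F a b s) q"
    and F: "\<And>a b. F a b \<in> hardy_H2"
begin

abbreviation (input) "err \<equiv> model_error F d B C"
abbreviation (input) "cc l \<equiv> gram_stack (\<lambda>a. column l (C a))"
abbreviation (input) "bb l \<equiv> gram_stack (\<lambda>b. conj_row l (B b))"
abbreviation (input) "Err s \<equiv> block_family (\<lambda>a b. err a b s)"

lemma err_reproduced: "reproduced (err a b)"
  using reproduced_add[OF hardy_H2_reproduced[OF F[of a b]] reproduced_scaleR[OF model_reproduced[OF stable, of B C a b], of "-1"]]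
  by (simp add: model_error_def[abs_def])

text \<open>
  Optimality in terms of pole-residue data. With all poles in the open left half-plane, the transfer
  functions agree with their pole-residue forms on the imaginary axis, and no other values enter the norm.
\<close>

lemma variation:
  fixes d' :: "'t::real_normed_vector \<Rightarrow> complex ^ 'r"
  assumes "0 < \<delta>" "\<And>t k. norm t < \<delta> \<Longrightarrow> Re (d' t $ k) < 0"
    and "d' 0 = d" "B' 0 = B" "C' 0 = C"
    and cont: "isCont d' 0" "\<And>b. isCont (\<lambda>t. B' t b) 0" "\<And>a. isCont (\<lambda>t. C' t a) 0"
    and D: "\<And>t a b s. model (d' t) (B' t) (C' t) a b s = model d B C a b s + D t a b s"
    and DL: "\<And>t a b. norm t < \<delta> \<Longrightarrow> axis_L2 (D t a b)"
  shows "\<exists>\<eta>>0. \<forall>t::'t. norm t < \<eta> \<longrightarrow> 2 * tensor_inner err (D t) \<le> tensor_inner (D t) (D t)"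
proof (rule optimality_variation[OF opt, where \<rho>="\<lambda>t. (diag_matrix (d' t), B' t False, B' t True, C' t False, C' t True)" and \<delta>=\<delta>])
  have ne: "\<i> * complex_of_real \<omega> \<noteq> z" if "Re z < 0" for z \<omega> using that by auto
  show "H (\<i> * complex_of_real \<omega>) q - rom_transfer (diag_matrix d, B False, B True, C False, C True) (\<i> * complex_of_real \<omega>) q
        = pencil (\<lambda>a b. err a b (\<i> * complex_of_real \<omega>)) q" for \<omega> q
    by (subst rom_transfer_eq_pencil[OF ne[OF stable]])
       (simp add: H pencil_def model_error_def scaleR_diff_right sum_subtractf)
  show "axis_L2 (err a b)" for a b by (rule reproduced_axis_L2[OF err_reproduced])
  show "(diag_matrix (d' 0), B' 0 False, B' 0 True, C' 0 False, C' 0 True) = (diag_matrix d, B False, B True, C False, C True)"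
    using assms(3-5) by simp
  have "isCont (\<lambda>t. diag_matrix (d' t)) 0"
    unfolding continuous_at
  proof (intro vec_tendstoI)
    fix i j
    have "((\<lambda>t. d' t $ i) \<longlongrightarrow> d' 0 $ i) (at 0)"
      using cont(1) unfolding continuous_at by (rule tendsto_vec_nth)
    then show "((\<lambda>t. diag_matrix (d' t) $ i $ j) \<longlongrightarrow> diag_matrix (d' 0) $ i $ j) (at 0)"
      by (cases "i = j") (simp_all add: diag_matrix_def)
  qed
  then show "isCont (\<lambda>t. (diag_matrix (d' t), B' t False, B' t True, C' t False, C' t True)) 0"
    using cont(2,3) by (intro continuous_Pair)
  show "(diag_matrix (d' t), B' t False, B' t True, C' t False, C' t True) \<in> admissible_roms" if "norm t < \<delta>" for t
    using assms(2)[OF that] unfolding admissible_roms_def by blast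
  show "rom_transfer (diag_matrix (d' t), B' t False, B' t True, C' t False, C' t True) (\<i> * complex_of_real \<omega>) q
        = rom_transfer (diag_matrix d, B False, B True, C False, C True) (\<i> * complex_of_real \<omega>) q
          + pencil (\<lambda>a b. D t a b (\<i> * complex_of_real \<omega>)) q" if "norm t < \<delta>" for t \<omega> q
    by (subst rom_transfer_eq_pencil[OF ne[OF stable]], subst rom_transfer_eq_pencil[OF ne[OF assms(2)[OF that]]])
       (simp add: pencil_def D scaleR_add_right sum.distrib)
qed (use assms in auto)


text \<open>
  For a change that is linear in \<open>t\<close>, the inequality is \<open>2 t x \<le> t\<^sup>2 y\<close> for small \<open>t\<close> of either sign, so
  \<open>x = 0\<close>.
\<close>

lemma linear_stationary:
  assumes ex: "\<exists>\<eta>>0. \<forall>t::real. norm t < \<eta> \<longrightarrow>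
      2 * tensor_inner err (\<lambda>a b s. t *\<^sub>R cauchy_kernel (d $ l) (rank_one (\<gamma> a) (\<beta> b)) s)
        \<le> tensor_inner (\<lambda>a b s. t *\<^sub>R cauchy_kernel (d $ l) (rank_one (\<gamma> a) (\<beta> b)) s)
            (\<lambda>a b s. t *\<^sub>R cauchy_kernel (d $ l) (rank_one (\<gamma> a) (\<beta> b)) s)"
  shows "Re (row_times_col (conj_vec (gram_stack \<gamma>)) (Err (- cnj (d $ l)) *v gram_stack \<beta>)) = 0"
proof -
  let ?K = "\<lambda>a b. cauchy_kernel (d $ l) (rank_one (\<gamma> a) (\<beta> b))"
  have right: "tensor_inner X (\<lambda>a b s. t *\<^sub>R ?K a b s) = t * tensor_inner X ?K" for X t
    by (simp add: tensor_inner_commute[of X] tensor_inner_scaleR_left)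
  obtain \<eta> where \<eta>: "0 < \<eta>" "\<And>t. \<bar>t\<bar> < \<eta> \<Longrightarrow> 2 * (t * tensor_inner err ?K) \<le> t\<^sup>2 * tensor_inner ?K ?K"
    using ex by (auto simp: right tensor_inner_scaleR_left power2_eq_square mult.assoc)
  have "tensor_inner err ?K = 0"
    by (rule quadratic_dominates_imp_zero[OF \<eta>])
  then show ?thesis
    using tensor_inner_cauchy_kernel[of err "d $ l" \<gamma> \<beta>] err_reproduced stable by simp
qed

lemma left_interpolation: "conj_vec (cc l) v* Err (- cnj (d $ l)) = 0"
proof (rule Re_row_times_col_eq_0)
  fix v :: "complex ^ ('ni + 'ni)"
  obtain \<beta> where \<beta>: "gram_stack \<beta> = v" using gram_stack_surj by blast
  have "\<exists>\<eta>>0. \<forall>t::real. norm t < \<eta> \<longrightarrow>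
      2 * tensor_inner err (\<lambda>a b s. t *\<^sub>R cauchy_kernel (d $ l) (rank_one (column l (C a)) (\<beta> b)) s)
        \<le> tensor_inner (\<lambda>a b s. t *\<^sub>R cauchy_kernel (d $ l) (rank_one (column l (C a)) (\<beta> b)) s)
            (\<lambda>a b s. t *\<^sub>R cauchy_kernel (d $ l) (rank_one (column l (C a)) (\<beta> b)) s)"
    by (rule variation[where \<delta>=1 and d'="\<lambda>_. d" and B'="\<lambda>t b. B b + t *\<^sub>R rank_one (axis l 1) (\<beta> b)" and C'="\<lambda>_. C"])
       (auto simp: stable model_perturb_B intro!: continuous_intros axis_L2_scaleR reproduced_axis_L2 reproduced_scaleR cauchy_kernel_reproduced)
  from linear_stationary[OF this]
  show "Re (row_times_col (conj_vec (cc l) v* Err (- cnj (d $ l))) v) = 0"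
    by (simp add: \<beta> row_times_col_vector_matrix)
qed

lemma right_interpolation: "Err (- cnj (d $ l)) *v bb l = 0"
proof (rule Re_row_times_col_eq_0)
  fix v :: "complex ^ ('no + 'no)"
  obtain \<gamma> where \<gamma>: "gram_stack \<gamma> = conj_vec v" using gram_stack_surj by blast
  have "\<exists>\<eta>>0. \<forall>t::real. norm t < \<eta> \<longrightarrow>
      2 * tensor_inner err (\<lambda>a b s. t *\<^sub>R cauchy_kernel (d $ l) (rank_one (\<gamma> a) (conj_row l (B b))) s)
        \<le> tensor_inner (\<lambda>a b s. t *\<^sub>R cauchy_kernel (d $ l) (rank_one (\<gamma> a) (conj_row l (B b))) s)
            (\<lambda>a b s. t *\<^sub>R cauchy_kernel (d $ l) (rank_one (\<gamma> a) (conj_row l (B b))) s)"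
    by (rule variation[where \<delta>=1 and d'="\<lambda>_. d" and B'="\<lambda>_. B" and C'="\<lambda>t a. C a + t *\<^sub>R rank_one (\<gamma> a) (axis l 1)"])
       (auto simp: stable model_perturb_C intro!: continuous_intros axis_L2_scaleR reproduced_axis_L2 reproduced_scaleR cauchy_kernel_reproduced)
  from linear_stationary[OF this]
  show "Re (row_times_col (Err (- cnj (d $ l)) *v bb l) v) = 0"
    by (simp add: \<gamma> row_times_col_commute)
qed

text \<open>
  The perturbation \<open>t\<close> of the pole is complex; it moves the interpolation point \<open>- cnj p\<close> by
  \<open>- cnj t\<close>, which takes every direction.
\<close>

lemma bitangential_derivative:
  "row_times_col (conj_vec (cc l)) (matrix_deriv Err (- cnj (d $ l)) *v bb l) = 0"
proof -
  let ?p = "d $ l" and ?\<mu> = "- cnj (d $ l)"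
  let ?V = "\<lambda>a b. rank_one (column l (C a)) (conj_row l (B b))"
  let ?D = "\<lambda>t a b s. cauchy_kernel (?p + t) (?V a b) s - cauchy_kernel ?p (?V a b) s"
  define e where "e s = row_times_col (conj_vec (cc l)) (Err s *v bb l)" for s
  define \<delta> where "\<delta> = - Re ?p / 2"
  have p: "Re ?p < 0" by (rule stable)
  have \<delta>: "0 < \<delta>" using p by (simp add: \<delta>_def)
  have pt: "Re (?p + t) < 0" if "cmod t < \<delta>" for t
    using that p complex_Re_le_cmod[of t] unfolding \<delta>_def plus_complex.sel by linarith
  have KL: "axis_L2 (cauchy_kernel z V)" if "Re z < 0" for z and V :: "complex ^ 'ni ^ 'no"
    using that by (intro reproduced_axis_L2 cauchy_kernel_reproduced)
  have DL: "axis_L2 (?D t a b)" if "cmod t < \<delta>" for t a b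
    using axis_L2_add[OF KL[OF pt[OF that]] axis_L2_scaleR[OF KL[OF p], of "-1"]] by simp
  have inner_e: "tensor_inner err (?D t) = Re (e (?\<mu> + - cnj t) - e ?\<mu>)" if t: "cmod t < \<delta>" for t
  proof -
    have L: "tensor_inner err (?D t) = tensor_inner (\<lambda>a b s. cauchy_kernel (?p + t) (?V a b) s + (-1) *\<^sub>R cauchy_kernel ?p (?V a b) s) err"
      by (subst tensor_inner_commute) simp
    also have "\<dots> = tensor_inner (\<lambda>a b. cauchy_kernel (?p + t) (?V a b)) err + tensor_inner (\<lambda>a b s. (-1) *\<^sub>R cauchy_kernel ?p (?V a b) s) err"
      by (intro tensor_inner_add_left axis_L2_scaleR KL p pt t reproduced_axis_L2 err_reproduced)
    also have "\<dots> = tensor_inner err (\<lambda>a b. cauchy_kernel (?p + t) (?V a b)) - tensor_inner err (\<lambda>a b. cauchy_kernel ?p (?V a b))"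
      unfolding tensor_inner_scaleR_left by (simp add: tensor_inner_commute[of err])
    also have "\<dots> = Re (e (- cnj (?p + t))) - Re (e ?\<mu>)"
      unfolding e_def by (simp only: tensor_inner_cauchy_kernel[OF err_reproduced p] tensor_inner_cauchy_kernel[OF err_reproduced pt[OF t]])
    finally show ?thesis by simp
  qed
  obtain \<eta> where \<eta>: "0 < \<eta>" "\<And>t. cmod t < \<eta> \<Longrightarrow> 2 * tensor_inner err (?D t) \<le> tensor_inner (?D t) (?D t)"
  proof -
    have "\<exists>\<eta>>0. \<forall>t::complex. norm t < \<eta> \<longrightarrow> 2 * tensor_inner err (?D t) \<le> tensor_inner (?D t) (?D t)"
    proof (rule variation[where \<delta>=\<delta> and d'="\<lambda>t. d + axis l t" and B'="\<lambda>_. B" and C'="\<lambda>_. C"])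
      show "Re ((d + axis l t) $ k) < 0" if "norm t < \<delta>" for t k
        using pt[OF that] stable[of k] by (auto simp: axis_def)
      show "isCont (\<lambda>t. d + axis l t) 0"
        unfolding continuous_at
      proof (rule vec_tendstoI)
        show "((\<lambda>t. (d + axis l t) $ i) \<longlongrightarrow> (d + axis l 0) $ i) (at 0)" for i
          by (cases "i = l") (auto simp: axis_def intro!: tendsto_eq_intros)
      qed
      show "d + axis l 0 = d" by (simp add: vec_eq_iff axis_def)
    qed (use \<delta> DL in \<open>auto simp: model_perturb_pole\<close>)
    then show ?thesis using that by blast
  qed
  define K where "K a b a' b' = (SOME k. \<forall>t. cmod t \<le> - Re ?p / 2 \<longrightarrow> H2_inner (?D t a b) (?D t a' b') \<le> k * (cmod t)\<^sup>2)"
    for a b a' b'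
  have K: "H2_inner (?D t a b) (?D t a' b') \<le> K a b a' b' * (cmod t)\<^sup>2" if "cmod t \<le> - Re ?p / 2" for a b a' b' t
    using someI_ex[OF H2_inner_cauchy_kernel_increment_le[OF p, of "?V a b" "?V a' b'"]] that
    unfolding K_def[symmetric] by simp
  define K' where "K' = (\<Sum>a\<in>UNIV. \<Sum>b\<in>UNIV. \<Sum>a'\<in>UNIV. \<Sum>b'\<in>UNIV. gram a a' * gram b b' * K a b a' b')"
  have TD: "tensor_inner (?D t) (?D t) \<le> K' * (cmod t)\<^sup>2" if "cmod t < \<delta>" for t
    unfolding tensor_inner_def K'_def sum_distrib_right mult.assoc
    by (intro sum_mono mult_left_mono K) (use that in \<open>auto simp: gram_def \<delta>_def\<close>)
  have ent: "(\<lambda>s. Err s $ i $ j) holomorphic_on {s. 0 < Re s}" for i j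
    by (rule block_family_holomorphic[OF err_reproduced])
  have der: "((\<lambda>s. Err s $ i $ j) has_field_derivative matrix_deriv Err ?\<mu> $ i $ j) (at ?\<mu>)" for i j
    using holomorphic_derivI[OF ent open_halfspace_Re_gt, of ?\<mu> i j] p by (simp add: matrix_deriv_def)
  have "(e has_field_derivative row_times_col (conj_vec (cc l)) (matrix_deriv Err ?\<mu> *v bb l)) (at ?\<mu>)"
    unfolding e_def[abs_def] row_times_col_def matrix_vector_mult_def vec_lambda_beta
    by (intro DERIV_sum DERIV_cmult DERIV_cmult_right der)
  then show ?thesis
  proof (rule deriv_zero_of_quadratic_bound[where \<delta>="min \<delta> \<eta>" and K="K' / 2"])
    show "0 < min \<delta> \<eta>" using \<delta> \<eta> by simp
    show "Re (e (?\<mu> + \<tau>) - e ?\<mu>) \<le> K' / 2 * (cmod \<tau>)\<^sup>2" if "cmod \<tau> < min \<delta> \<eta>" for \<tau>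
      using inner_e[of "- cnj \<tau>"] \<eta>(2)[of "- cnj \<tau>"] TD[of "- cnj \<tau>"] that by simp
  qed
qed

end

theorem theorem4p1:
  fixes H11 H12 H21 H22 :: "complex \<Rightarrow> complex ^ 'ni ^ 'no"
    and H :: "complex \<Rightarrow> real \<times> real \<Rightarrow> complex ^ 'ni ^ 'no"
    and lam :: "complex ^ 'r"
    and A :: "complex ^ 'r ^ 'r"
    and B1 B2 :: "complex ^ 'ni ^ 'r"
    and C1 C2 :: "complex ^ 'r ^ 'no"
    and HH HHr :: "complex \<Rightarrow> complex ^ ('ni + 'ni) ^ ('no + 'no)"
    and b1 b2 :: "'r \<Rightarrow> complex ^ 'ni"
    and c1 c2 :: "'r \<Rightarrow> complex ^ 'no"
    and bb :: "'r \<Rightarrow> complex ^ ('ni + 'ni)"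
    and cc :: "'r \<Rightarrow> complex ^ ('no + 'no)"
  assumes H2: "H11 \<in> hardy_H2" "H12 \<in> hardy_H2" "H21 \<in> hardy_H2" "H22 \<in> hardy_H2"
    and H: "\<And>s q1 q2. H s (q1, q2) =
              H11 s + q1 *\<^sub>R H12 s + q2 *\<^sub>R H21 s + (q1 * q2) *\<^sub>R H22 s"
    and A: "A = diag_matrix lam"
    and stable: "\<And>l. Re (lam $ l) < 0"
    and HH: "\<And>s. HH s = block_matrix (H11 s) (H12 s) (H21 s) (H22 s)"
    and HHr: "\<And>s. HHr s = stack_rows C1 C2 ** matrix_inv (mat s - A) ** append_cols B1 B2"
    and b: "\<And>l. b1 l = conj_transpose B1 *v axis l 1" "\<And>l. b2 l = conj_transpose B2 *v axis l 1"
    and c: "\<And>l. c1 l = C1 *v axis l 1" "\<And>l. c2 l = C2 *v axis l 1"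
    and bb: "\<And>l. bb l =
              block_matrix (mat 1) (mat (1/2)) (mat (1/2)) (mat (1/3)) *v stack_vec (b1 l) (b2 l)"
    and cc: "\<And>l. cc l =
              block_matrix (mat 1) (mat (1/2)) (mat (1/2)) (mat (1/3)) *v stack_vec (c1 l) (c2 l)"
    and opt: "H2L2_optimal H (A, B1, B2, C1, C2)"
  shows "\<forall>l. HH (- cnj (lam $ l)) *v bb l = HHr (- cnj (lam $ l)) *v bb l
           \<and> conj_vec (cc l) v* HH (- cnj (lam $ l)) = conj_vec (cc l) v* HHr (- cnj (lam $ l))
           \<and> row_times_col (conj_vec (cc l)) (matrix_deriv HH (- cnj (lam $ l)) *v bb l)
             = row_times_col (conj_vec (cc l)) (matrix_deriv HHr (- cnj (lam $ l)) *v bb l)"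
proof -
  define F where "F = (\<lambda>a b. if a then (if b then H22 else H21) else (if b then H12 else H11))"
  define B where "B = (\<lambda>b. if b then B2 else B1)"
  define C where "C = (\<lambda>a. if a then C2 else C1)"
  have F: "F a b \<in> hardy_H2" for a b using H2 by (simp add: F_def)
  have Hp: "H s q = pencil (\<lambda>a b. F a b s) q" for s q
    by (cases q) (simp add: H pencil_def F_def UNIV_bool algebra_simps)
  have opt': "H2L2_optimal H (diag_matrix lam, B False, B True, C False, C True)"
    using opt by (simp add: A B_def C_def)
  have bbl: "bb l = gram_stack (\<lambda>b. conj_row l (B b))" for l
  proof -
    have "conj_transpose X *v axis l 1 = conj_row l X" for X :: "complex ^ 'ni ^ 'r"
      by (simp add: vec_eq_iff matrix_vector_mult_axis column_def conj_transpose_def conj_row_def)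
    then show ?thesis by (simp add: bb b gram_stack_def B_def)
  qed
  have ccl: "cc l = gram_stack (\<lambda>a. column l (C a))" for l
    by (simp add: cc c gram_stack_def C_def matrix_vector_mult_axis)
  interpret optimal_model H lam B C F
    by unfold_locales (fact stable opt' Hp F)+
  have FH: "HH = (\<lambda>s. block_family (\<lambda>a b. F a b s))" by (simp add: HH block_family_def F_def fun_eq_iff)
  have MH: "HHr s = block_family (\<lambda>a b. model lam B C a b s)" if s: "0 < Re s" for s
  proof -
    have ne: "s \<noteq> lam $ k" for k using s stable[of k] by auto
    show ?thesis
      using stacked_transfer_eq_block_family[OF ne, of C B] by (simp add: HHr A B_def C_def)
  qed
  \<comment> \<open>The resolvent has the pole-residue form only away from the poles, so values and derivatives of the
    error are compared on the open right half-plane.\<close>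
  have E: "block_family (\<lambda>a b. model_error F lam B C a b s) = HH s - HHr s" if s: "0 < Re s" for s
    unfolding FH MH[OF s]
    by (auto simp: vec_eq_iff block_family_def block_matrix_def model_error_def split: sum.split)
  have hol: "(\<lambda>s. HH s $ i $ j) holomorphic_on {s. 0 < Re s}" "(\<lambda>s. HHr s $ i $ j) holomorphic_on {s. 0 < Re s}" for i j
  proof -
    show "(\<lambda>s. HH s $ i $ j) holomorphic_on {s. 0 < Re s}"
      unfolding FH by (rule block_family_holomorphic[OF hardy_H2_reproduced[OF F]])
    show "(\<lambda>s. HHr s $ i $ j) holomorphic_on {s. 0 < Re s}"
    proof (rule holomorphic_transform)
      show "(\<lambda>s. block_family (\<lambda>a b. model lam B C a b s) $ i $ j) holomorphic_on {s. 0 < Re s}"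
        by (intro block_family_holomorphic model_reproduced stable)
    qed (simp add: MH)
  qed
  have dE: "matrix_deriv (\<lambda>s. block_family (\<lambda>a b. model_error F lam B C a b s)) \<mu> = matrix_deriv HH \<mu> - matrix_deriv HHr \<mu>"
    if \<mu>: "0 < Re \<mu>" for \<mu>
  proof -
    have ev: "\<forall>\<^sub>F s in nhds \<mu>. 0 < Re s"
      using eventually_nhds_in_open[OF open_halfspace_Re_gt[of 0], of \<mu>] \<mu> by simp
    have diff: "(\<lambda>s. HH s $ i $ j) field_differentiable at \<mu>" "(\<lambda>s. HHr s $ i $ j) field_differentiable at \<mu>" for i j
      using hol[of i j] \<mu> by (auto intro!: holomorphic_on_imp_differentiable_at open_halfspace_Re_gt)
    have "deriv (\<lambda>s. block_family (\<lambda>a b. model_error F lam B C a b s) $ i $ j) \<mu> = deriv (\<lambda>s. HH s $ i $ j - HHr s $ i $ j) \<mu>" for i j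
      by (rule deriv_cong_ev[OF eventually_mono[OF ev]]) (auto simp: E)
    then show ?thesis
      by (simp add: vec_eq_iff matrix_deriv_def deriv_diff[OF diff])
  qed
  show ?thesis
  proof (intro allI conjI)
    fix l
    let ?\<mu> = "- cnj (lam $ l)"
    have \<mu>: "0 < Re ?\<mu>" using stable[of l] by simp
    show "HH ?\<mu> *v bb l = HHr ?\<mu> *v bb l"
      using right_interpolation[of l] unfolding E[OF \<mu>] bbl by (simp add: matrix_vector_mult_diff_rdistrib)
    have "x v* (X - Y) = x v* X - x v* Y" for x and X Y :: "complex ^ ('ni + 'ni) ^ ('no + 'no)"
      by (simp add: vec_eq_iff vector_matrix_mult_def algebra_simps sum_subtractf)
    then show "conj_vec (cc l) v* HH ?\<mu> = conj_vec (cc l) v* HHr ?\<mu>"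
      using left_interpolation[of l] unfolding E[OF \<mu>] ccl by simp
    show "row_times_col (conj_vec (cc l)) (matrix_deriv HH ?\<mu> *v bb l)
       = row_times_col (conj_vec (cc l)) (matrix_deriv HHr ?\<mu> *v bb l)"
      using bitangential_derivative[of l] unfolding dE[OF \<mu>] bbl[symmetric] ccl[symmetric]
      by (simp add: matrix_vector_mult_diff_rdistrib row_times_col_def algebra_simps sum_subtractf)
  qed
qed

end
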